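(* Let $\mathbb{G}$ be a homogeneous Lie group of homogeneous dimension $Q$, $|\cdot|$ any homogeneous quasi-norm, $R>0$, $B(0,R)=\{x\in\mathbb{G}:|x|<R\}$, $1<p<\infty$, $\alpha,\beta\in\mathbb{R}$, and $L(x)=\log\frac{R}{|x|}$. (i) If $(Q-\alpha-p)(\beta+p)\ge0$, then for all complex-valued $f\in C_0^\infty(B(0,R)\setminus\{0\})$, $$\left|\frac{\beta+p}{p}\right|^p\int_{B(0,R)}\frac{|f|^p}{|x|^{\alpha+p}L^{\beta+p+1}}dx\le\int_{B(0,R)}\frac{|\mathcal{R}_{|x|}f|^p}{|x|^{\alpha}L^{\beta+1}}dx,$$ and when $\beta\neq-p$ the constant $\left|\frac{\beta+p}{p}\right|^p$ is sharp. (ii) For all complex-valued $f\in C_0^\infty(B(0,R)\setminus\{0\})$, $$\left|\frac{\beta+p}{p}\right|^p\int_{B(0,R)}\frac{|f|^p}{|x|^{\alpha+p}L^{\beta+p+1}}dx=\int_{B(0,R)}\frac{|\mathcal{R}_{|x|}f|^p}{|x|^{\alpha}L^{\beta+1}}dx-(Q-\alpha-p)\frac{\beta+p}{p}\left|\frac{\beta+p}{p}\right|^{p-2}\int_{B(0,R)}\frac{|f|^p}{|x|^{\alpha+p}L^{\beta+p}}dx-\int_{B(0,R)}C_p(\xi,\eta)dx,$$ where $\xi=\dfrac{\mathcal{R}_{|x|}f}{|x|^{\alpha/p}L^{(\beta+1)/p}}$ and $\eta=\xi+\dfrac{\beta+p}{p}\dfrac{f}{|x|^{(\alpha+p)/p}L^{(\beta+p+1)/p}}$.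 (iii) If $Q=\alpha+p$ and $p\ge2$, then $\int_{B(0,R)}C_p(\xi,\eta)dx$ vanishes only if $f=L^{(\beta+p)/p}\varphi(x/|x|)$ for some $\varphi:\mathfrak{S}\to\mathbb{C}$, which for $f\in C_0^\infty(B(0,R)\setminus\{0\})$ forces $f=0$; hence the inequality in (i) is strict for every nonzero such $f$.
   Context: A homogeneous Lie group is a connected simply connected (nilpotent) Lie group $\mathbb{G}$, identified with $\mathbb{R}^n$, whose Lie algebra carries dilations $D_\lambda=\exp(A\ln\lambda)$ with $A$ diagonalisable with positive eigenvalues and each $D_\lambda$ a Lie algebra automorphism, inducing dilations $x\mapsto\lambda x$ on $\mathbb{G}$; $Q=\operatorname{Tr}A$ and the Haar (Lebesgue) measure satisfies $\int f(\lambda x)dx=\lambda^{-Q}\int f dx$. A homogeneous quasi-norm is a continuous $|\cdot|:\mathbb{G}\to[0,\infty)$ with $|x^{-1}|=|x|$, $|\lambda x|=\lambda|x|$, $|x|=0$ iff $x=0$. $\mathfrak{S}=\{|x|=1\}$ and there is a Borel measure $\sigma$ on $\mathfrak{S}$ with $\int_{\mathbb{G}}f\,dx=\int_0^\infty\int_{\mathfrak{S}}f(ry)r^{Q-1}d\sigma(y)dr$. The radial derivative is $\mathcal{R}_{|x|}f(x)=\frac{d}{dr}f(ry)$ at $r=|x|$, $y=x/|x|$. For complex $\xi,\eta$, $C_p(\xi,\eta):=|\xi|^p-|\xi-\eta|^p-p|\xi-\eta|^{p-2}\operatorname{Re}((\xi-\eta)\overline{\eta})$ (last term $0$ when $\xi=\eta$).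 *)

theory Defs
  imports "HOL-Analysis.Analysis"
begin

definition dirderiv :: "('a::real_normed_vector \<Rightarrow> 'b::real_normed_vector) \<Rightarrow> 'a \<Rightarrow> 'a \<Rightarrow> 'b" where
  "dirderiv f v x = frechet_derivative f (at x) v"

fun iter_dirderiv :: "('a::real_normed_vector \<Rightarrow> 'b::real_normed_vector) \<Rightarrow> 'a list \<Rightarrow> 'a \<Rightarrow> 'b" where
  "iter_dirderiv f [] = f"
| "iter_dirderiv f (v # vs) = dirderiv (iter_dirderiv f vs) v"

definition smooth_fun :: "('a::real_normed_vector \<Rightarrow> 'b::real_normed_vector) \<Rightarrow> bool" where
  "smooth_fun f \<longleftrightarrow> (\<forall>vs x. iter_dirderiv f vs differentiable (at x))"

section \<open>Homogeneous Lie groups on R^n (coordinates adapted to the dilations)\<close>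

text \<open>Dilations x \<mapsto> \<lambda>x with positive weights nu (eigenvalues of A).\<close>
definition dil :: "('n::finite \<Rightarrow> real) \<Rightarrow> real \<Rightarrow> real^'n \<Rightarrow> real^'n" where
  "dil \<nu> r x = (\<chi> i. r powr (\<nu> i) * x $ i)"

definition hom_dim :: "('n::finite \<Rightarrow> real) \<Rightarrow> real" where
  "hom_dim \<nu> = (\<Sum>i\<in>UNIV. \<nu> i)"

definition homogeneous_group ::
  "('n::finite \<Rightarrow> real) \<Rightarrow> (real^'n \<Rightarrow> real^'n \<Rightarrow> real^'n) \<Rightarrow> (real^'n \<Rightarrow> real^'n) \<Rightarrow> bool" where
  "homogeneous_group \<nu> mul ginv \<longleftrightarrow>
     (\<forall>x y z. mul (mul x y) z = mul x (mul y z)) \<and>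
     (\<forall>x. mul 0 x = x \<and> mul x 0 = x) \<and>
     (\<forall>x. mul (ginv x) x = 0 \<and> mul x (ginv x) = 0) \<and>
     smooth_fun (\<lambda>(x, y). mul x y) \<and> smooth_fun ginv \<and>
     (\<forall>i. \<nu> i > 0) \<and>
     (\<forall>r>0. \<forall>x y. dil \<nu> r (mul x y) = mul (dil \<nu> r x) (dil \<nu> r y))"

definition hom_quasi_norm ::
  "('n::finite \<Rightarrow> real) \<Rightarrow> (real^'n \<Rightarrow> real^'n) \<Rightarrow> (real^'n \<Rightarrow> real) \<Rightarrow> bool" where
  "hom_quasi_norm \<nu> ginv q \<longleftrightarrow>
     continuous_on UNIV q \<and> (\<forall>x. q x \<ge> 0) \<and> (\<forall>x. q (ginv x) = q x) \<and>
     (\<forall>r>0. \<forall>x. q (dil \<nu> r x) = r * q x) \<and> (\<forall>x. q x = 0 \<longleftrightarrow> x = 0)"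

definition radial_deriv ::
  "('n::finite \<Rightarrow> real) \<Rightarrow> (real^'n \<Rightarrow> real) \<Rightarrow> (real^'n \<Rightarrow> complex) \<Rightarrow> real^'n \<Rightarrow> complex" where
  "radial_deriv \<nu> q f x = vector_derivative (\<lambda>r. f (dil \<nu> r (dil \<nu> (1 / q x) x))) (at (q x))"

text \<open>Test functions C_0^infinity(B(0,R) \ {0}), extended by zero to all of R^n.\<close>
definition test_fun :: "(real^'n::finite \<Rightarrow> real) \<Rightarrow> real \<Rightarrow> (real^'n \<Rightarrow> complex) \<Rightarrow> bool" where
  "test_fun q R f \<longleftrightarrow> smooth_fun f \<and> compact (closure {x. f x \<noteq> 0}) \<and>
     closure {x. f x \<noteq> 0} \<subseteq> {x. q x < R} - {0}"

definition logw :: "(real^'n::finite \<Rightarrow> real) \<Rightarrow> real \<Rightarrow> real^'n \<Rightarrow> real" where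
  "logw q R x = ln (R / q x)"

definition Cp :: "real \<Rightarrow> complex \<Rightarrow> complex \<Rightarrow> real" where
  "Cp p \<xi> \<eta> = (if \<xi> = \<eta> then cmod \<xi> powr p
     else cmod \<xi> powr p - cmod (\<xi> - \<eta>) powr p
          - p * cmod (\<xi> - \<eta>) powr (p - 2) * Re ((\<xi> - \<eta>) * cnj \<eta>))"

definition wint :: "(real^'n::finite \<Rightarrow> real) \<Rightarrow> real \<Rightarrow> real \<Rightarrow> real \<Rightarrow> (real^'n \<Rightarrow> real) \<Rightarrow> real" where
  "wint q R a b g = (LINT x:{x. q x < R}|lebesgue. g x / (q x powr a * logw q R x powr b))"

definition xi_fun where
  "xi_fun \<nu> q R \<alpha> \<beta> p f x =
     radial_deriv \<nu> q f x / complex_of_real (q x powr (\<alpha> / p) * logw q R x powr ((\<beta> + 1) / p))"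

definition eta_fun where
  "eta_fun \<nu> q R \<alpha> \<beta> p f x =
     xi_fun \<nu> q R \<alpha> \<beta> p f x + complex_of_real ((\<beta> + p) / p) * f x /
       complex_of_real (q x powr ((\<alpha> + p) / p) * logw q R x powr ((\<beta> + p + 1) / p))"

end

theory Submission
  imports Defs
begin

text \<open>
  No polar coordinates are needed. Differentiating
  \<open>\<integral> h(\<lambda>x) dx = \<lambda>\<^sup>-\<^sup>Q \<integral> h dx\<close> at \<open>\<lambda> = 1\<close> gives \<open>\<integral> Eh dx = - Q \<integral> h dx\<close> for the Euler field \<open>E\<close> that
  generates the dilations, and \<open>E = |x| \<R>\<close>. For \<open>h = |f|\<^sup>p |x|\<^bsup>-\<alpha>-p\<^esup> L\<^bsup>-\<beta>-p\<^esup>\<close> this is exactly the identity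
  (ii), because \<open>C\<^sub>p\<close> is homogeneous of degree \<open>p\<close> and its weighted arguments can be expanded pointwise.
  Part (i) follows from \<open>C\<^sub>p \<ge> 0\<close>. If the remainder vanishes, then \<open>\<eta> = 0\<close> everywhere by continuity, which is a
  linear differential equation along each dilation orbit, and \<open>f\<close> vanishes near the ends of the orbit.

  For the sharpness, the quasi-norm is merely continuous, so radial functions are not admissible.
  Instead the test functions live in a tube around a coordinate axis, very close to the sphere
  \<open>|x| = R\<close>, and are products of functions of one coordinate. Near the sphere \<open>L\<close> is
  asymptotically linear in the distance \<open>s\<close> along the axis, the derivatives transversal to the axis
  are negligible, and what remains is the Hardy inequality on the half-line with the near-extremals
  \<open>s\<^bsup>(\<beta>+p)/p\<^esup> H(ln s / N)\<close> for a bump function \<open>H\<close> and large \<open>N\<close>.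
\<close>

section \<open>Dilations and integration\<close>

text \<open>Where sharpness has to be tested is dictated by the remainder. An extremal f would have
  \<eta> = 0, that is f = L^\<kappa> \<phi>(x/|x|) with \<kappa> = (\<beta>+p)/p, and with this f
  the integrals diverge logarithmically at |x| = R. At that sphere |x|^(\<alpha>+p) freezes to a
  constant, and the middle term of (ii) carries one more factor L, so it is of lower order; only
  \<beta> and p enter the best constant. The obstacle is that transversally to the axis nothing but
  continuity of the quasi-norm is available. It is met by fixing the scales in order. A parameter m
  puts the support at distance of order 1/m from the sphere, where L also has size 1/m. Only then is
  the width \<delta> of the tube chosen, so small that ln |x| changes by at most 1/m^2 across it. A
  tiny \<delta> costs nothing, because x_i d/dx_i is invariant under rescaling of x_i: the
  transversal part of the Euler field stays bounded while the axial part grows like m. Both sides of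
  the inequality then carry the same power m^(\<beta>+p+1), which cancels.\<close>

lemma axis_nth_if: "axis i a $ j = (if j = i then a else 0)"
  by (simp add: axis_def)

text \<open>\<open>lborel_affine_euclidean\<close> indexes its factors by \<open>Basis\<close>; the
  coordinate family is carried over along the injection of indices \<open>i\<close> to
  \<open>axis i 1\<close>. The shift \<open>d\<close> is zero for dilations; for
  \<open>tube_map\<close> it moves the origin to a point of the axis.\<close>

lemma lborel_integral_diagonal_affine:
  fixes a d :: "'n::finite \<Rightarrow> real" and f :: "real^'n \<Rightarrow> real"
  assumes f: "f \<in> borel_measurable borel" and a: "\<And>i. a i \<noteq> 0"
  shows "integral\<^sup>L lborel f = (\<Prod>i\<in>UNIV. \<bar>a i\<bar>) * (LBINT x. f (\<chi> i. d i + a i * x $ i))"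
proof -
  define c :: "real^'n \<Rightarrow> real" where "c j = a (SOME i. j = axis i 1)" for j
  have c_axis: "c (axis i 1) = a i" for i
  proof -
    have "(SOME k. axis i (1::real) = axis k 1) = i"
      by (rule some_equality) (auto simp: axis_eq_axis)
    then show ?thesis by (simp add: c_def)
  qed
  have basis: "(Basis :: (real^'n) set) = range (\<lambda>i. axis i 1)"
    by (auto simp: Basis_vec_def)
  have inj: "inj (\<lambda>i::'n. axis i (1::real))"
    by (auto simp: inj_on_def axis_eq_axis)
  have T: "(\<chi> i. d i) + (\<Sum>j\<in>Basis. (c j * (x \<bullet> j)) *\<^sub>R j) = (\<chi> i. d i + a i * x $ i)" for x :: "real^'n"
    unfolding basis sum.reindex[OF inj]
    by (simp add: vec_eq_iff c_axis inner_axis axis_nth_if if_distrib sum.delta' cong: if_cong)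
  have c0: "c j \<noteq> 0" if "j \<in> Basis" for j
    using that a c_axis by (auto simp: basis)
  have prod: "(\<Prod>j\<in>Basis. \<bar>c j\<bar>) = (\<Prod>i\<in>UNIV. \<bar>a i\<bar>)"
    unfolding basis prod.reindex[OF inj] by (simp add: c_axis)
  have mT[measurable]: "(\<lambda>x::real^'n. \<chi> i. d i + a i * x $ i) \<in> borel \<rightarrow>\<^sub>M borel"
    by (intro borel_measurable_continuous_onI continuous_intros)
  have "lborel = density (distr lborel borel (\<lambda>x::real^'n. \<chi> i. d i + a i * x $ i))
      (\<lambda>_. ennreal (\<Prod>i\<in>UNIV. \<bar>a i\<bar>))"
    using lborel_affine_euclidean[of c "\<chi> i. d i", OF c0] by (simp add: T prod)
  then have "integral\<^sup>L lborel f
      = integral\<^sup>L (density (distr lborel borel (\<lambda>x::real^'n. \<chi> i. d i + a i * x $ i))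
          (\<lambda>_. ennreal (\<Prod>i\<in>UNIV. \<bar>a i\<bar>))) f"
    by simp
  also have "\<dots> = (\<Prod>i\<in>UNIV. \<bar>a i\<bar>) * (LBINT x. f (\<chi> i. d i + a i * x $ i))"
    using f by (simp add: integral_density integral_distr prod_nonneg)
  finally show ?thesis .
qed

lemma integrable_lborel_compact_support:
  fixes g :: "'a::euclidean_space \<Rightarrow> real"
  assumes "compact K" "continuous_on K g" "\<And>x. x \<notin> K \<Longrightarrow> g x = 0"
  shows "integrable lborel g"
proof -
  have "(\<lambda>x. indicator K x *\<^sub>R g x) = g"
    using assms(3) by (auto simp: indicator_def fun_eq_iff)
  with borel_integrable_compact[OF assms(1,2)] show ?thesis by simp
qed

lemma bounded_by_compact_support:
  fixes g :: "'a::topological_space \<Rightarrow> real"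
  assumes "compact K" "continuous_on K g" "\<And>x. x \<notin> K \<Longrightarrow> g x = 0"
  obtains M where "M \<ge> 0" "\<And>x. \<bar>g x\<bar> \<le> M"
proof -
  have "bounded (g ` K)"
    using assms compact_continuous_image compact_imp_bounded by blast
  then obtain M where "\<forall>y\<in>g ` K. norm y \<le> M" by (auto simp: bounded_iff)
  then have "\<bar>g x\<bar> \<le> max 0 M" for x
    using assms(3)[of x] by (cases "x \<in> K") (force simp: max_def)+
  then show ?thesis using that[of "max 0 M"] by simp
qed

text \<open>A non-empty open set is not negligible. This upgrades almost-everywhere vanishing of a
  continuous function to vanishing everywhere.\<close>

lemma open_AE_imp_empty:
  fixes S :: "'a::euclidean_space set"
  assumes "open S" "AE x in lebesgue. x \<notin> S"
  shows "S = {}"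
proof (rule ccontr)
  assume "S \<noteq> {}"
  have "S \<in> null_sets lebesgue"
    using assms borel_open[OF assms(1)] by (subst AE_iff_null_sets) (auto intro: sets_completionI_sets)
  then show False
    using open_not_negligible[OF assms(1) \<open>S \<noteq> {}\<close>] by (simp add: negligible_iff_null_sets)
qed

lemma dil_1: "dil \<nu> 1 x = x"
  by (simp add: dil_def vec_eq_iff)

lemma dil_dil: "r > 0 \<Longrightarrow> s > 0 \<Longrightarrow> dil \<nu> r (dil \<nu> s x) = dil \<nu> (r * s) x"
  by (simp add: dil_def vec_eq_iff powr_mult)

text \<open>The generator of the dilations in the time variable \<open>t = ln r\<close>, in which
  they form a one-parameter group; hence derivatives are taken along
  \<open>dil \<nu> (exp t) x\<close>.\<close>

definition euler_field :: "('n::finite \<Rightarrow> real) \<Rightarrow> real^'n \<Rightarrow> real^'n" where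
  "euler_field \<nu> x = (\<chi> i. \<nu> i * x $ i)"

lemma dil_exp: "dil \<nu> (exp t) x = (\<chi> i. exp (t * \<nu> i) * x $ i)"
  by (simp add: dil_def powr_def mult.commute)

lemma dil_exp_has_vector_derivative:
  "((\<lambda>t. dil \<nu> (exp t) x) has_vector_derivative euler_field \<nu> (dil \<nu> (exp t) x)) (at t)"
proof -
  have "((\<lambda>t. \<Sum>i\<in>UNIV. (exp (t * \<nu> i) * x $ i) *\<^sub>R axis i (1::real)) has_vector_derivative
      (\<Sum>i\<in>UNIV. (\<nu> i * (exp (t * \<nu> i) * x $ i)) *\<^sub>R axis i 1)) (at t)"
    by (auto intro!: derivative_eq_intros has_vector_derivative_sum
        simp: has_real_derivative_iff_has_vector_derivative[symmetric])
  moreover have "(\<Sum>i\<in>UNIV. v i *\<^sub>R axis i (1::real)) = (\<chi> i. v i)" for v :: "'a \<Rightarrow> real"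
    by (simp add: vec_eq_iff axis_def if_distrib sum.delta' cong: if_cong)
  ultimately show ?thesis
    by (simp add: dil_exp euler_field_def)
qed

lemma continuous_on_dil_exp:
  "continuous_on S (\<lambda>z::real \<times> (real^'n::finite). dil \<nu> (exp (fst z)) (snd z))"
  unfolding dil_exp by (intro continuous_intros)

lemma lborel_integral_dil:
  fixes h :: "real^'n::finite \<Rightarrow> real"
  assumes "h \<in> borel_measurable borel"
  shows "(LBINT x. h (dil \<nu> (exp t) x)) = exp (- hom_dim \<nu> * t) * integral\<^sup>L lborel h"
proof -
  have "(\<Prod>i\<in>UNIV. \<bar>exp (t * \<nu> i)\<bar>) = exp (hom_dim \<nu> * t)"
    by (simp add: exp_sum[symmetric] hom_dim_def sum_distrib_left mult.commute)
  then have "integral\<^sup>L lborel h = exp (hom_dim \<nu> * t) * (LBINT x. h (dil \<nu> (exp t) x))"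
    using lborel_integral_diagonal_affine[OF assms, of "\<lambda>i. exp (t * \<nu> i)" "\<lambda>_. 0"]
    by (simp add: dil_exp)
  then show ?thesis by (simp add: exp_minus)
qed

text \<open>Differentiating the scaling law of the integral at the unit dilation replaces
  polar coordinates and integration by parts.\<close>
lemma integral_euler_derivative:
  fixes h D :: "real^'n::finite \<Rightarrow> real"
  assumes h: "integrable lborel h" and K: "compact K" and h0: "\<And>x. x \<notin> K \<Longrightarrow> h x = 0"
    and D: "\<And>x. ((\<lambda>t. h (dil \<nu> (exp t) x)) has_real_derivative D x) (at 0)"
    and M: "\<And>x. \<bar>D x\<bar> \<le> M"
  shows "integrable lborel D" "integral\<^sup>L lborel D = - hom_dim \<nu> * integral\<^sup>L lborel h"
proof -
  define s :: "nat \<Rightarrow> real" where "s n = 1 / real (Suc n)" for n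
  define u where "u n x = (h (dil \<nu> (exp (s n)) x) - h x) / s n" for n x
  \<comment> \<open>The points that reach \<open>K\<close> within unit time. Since all steps
    \<open>s n\<close> are at most 1, every difference quotient \<open>u n\<close> vanishes off this
    one compact set.\<close>
  define K' where "K' = (\<lambda>z. dil \<nu> (exp (fst z)) (snd z)) ` ({-1..0} \<times> K)"
  have K': "compact K'"
    unfolding K'_def using K by (intro compact_continuous_image continuous_on_dil_exp compact_Times) auto
  have mh[measurable]: "h \<in> borel_measurable borel" using h by auto
  have md[measurable]: "dil \<nu> r \<in> borel \<rightarrow>\<^sub>M borel" for r
    unfolding dil_def by (intro borel_measurable_continuous_onI continuous_intros)
  have mu[measurable]: "u n \<in> borel_measurable lborel" for n
    unfolding u_def by measurable
  have s: "s n > 0" "s n \<le> 1" for n by (auto simp: s_def)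
  have s_lim: "s \<longlonglongrightarrow> 0"
    unfolding s_def using LIMSEQ_inverse_real_of_nat by (simp add: inverse_eq_divide)
  \<comment> \<open>The group law carries the derivative from time 0 to every time, so the mean
    value theorem turns the bound on \<open>D\<close> into a bound on all quotients.\<close>
  have Dt: "((\<lambda>t. h (dil \<nu> (exp t) x)) has_real_derivative D (dil \<nu> (exp t) x)) (at t)" for x t
  proof -
    have "((\<lambda>r. h (dil \<nu> (exp r) (dil \<nu> (exp t) x))) has_real_derivative D (dil \<nu> (exp t) x)) (at (t + - t))"
      using D by simp
    then have "((\<lambda>r. h (dil \<nu> (exp (r + - t)) (dil \<nu> (exp t) x))) has_real_derivative D (dil \<nu> (exp t) x)) (at t)"
      by (simp only: DERIV_shift)
    then show ?thesis by (simp add: dil_dil exp_add[symmetric])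
  qed
  have lim: "(\<lambda>n. u n x) \<longlonglongrightarrow> D x" for x
  proof -
    have "((\<lambda>t. (h (dil \<nu> (exp t) x) - h x) / t) \<longlongrightarrow> D x) (at 0)"
      using D[of x] by (simp add: DERIV_def dil_1)
    moreover have "filterlim s (at 0) sequentially"
      using s_lim s(1) by (auto simp: filterlim_at intro!: always_eventually) (metis less_irrefl)
    ultimately show ?thesis
      unfolding u_def by (rule filterlim_compose)
  qed
  have bound: "\<bar>u n x\<bar> \<le> M * indicator K' x" for n x
  proof (cases "x \<in> K'")
    case True
    obtain z where "h (dil \<nu> (exp (s n)) x) - h (dil \<nu> (exp 0) x) = (s n - 0) * D (dil \<nu> (exp z) x)"
      using MVT2[OF s(1)[of n], of "\<lambda>t. h (dil \<nu> (exp t) x)" "\<lambda>t. D (dil \<nu> (exp t) x)"] Dt by blast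
    then have "u n x = D (dil \<nu> (exp z) x)"
      using s(1)[of n] by (simp add: u_def dil_1)
    then show ?thesis using M True by simp
  next
    case False
    have "dil \<nu> (exp t) x \<notin> K" if "0 \<le> t" "t \<le> 1" for t
    proof
      assume "dil \<nu> (exp t) x \<in> K"
      moreover have "x = dil \<nu> (exp (-t)) (dil \<nu> (exp t) x)"
        by (simp add: dil_dil exp_add[symmetric] dil_1)
      ultimately have "x \<in> K'"
        unfolding K'_def using that by (intro image_eqI[of _ _ "(-t, dil \<nu> (exp t) x)"]) auto
      with False show False by simp
    qed
    from this[of "s n"] this[of 0] have "u n x = 0"
      using s[of n] by (simp add: u_def h0 dil_1)
    then show ?thesis using False by simp
  qed
  have intM: "integrable lborel (\<lambda>x. M * indicator K' x :: real)"
    using borel_integrable_compact[OF K', of "\<lambda>_. M"] by (simp add: mult.commute)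
  have mD: "D \<in> borel_measurable lborel"
    by (rule borel_measurable_LIMSEQ_real[OF lim mu])
  show "integrable lborel D"
    by (rule integrable_dominated_convergence[where s = u and w = "\<lambda>x. M * indicator K' x"])
      (use mD mu intM lim bound in auto)
  have "(\<lambda>n. integral\<^sup>L lborel (u n)) \<longlonglongrightarrow> integral\<^sup>L lborel D"
    by (rule integral_dominated_convergence[where w = "\<lambda>x. M * indicator K' x"])
      (use mD mu intM lim bound in auto)
  moreover have "integral\<^sup>L lborel (u n) = (exp (- hom_dim \<nu> * s n) - 1) / s n * integral\<^sup>L lborel h" for n
  proof -
    \<comment> \<open>The dilated function equals \<open>s n * u n x + h x\<close>, and
      \<open>u n\<close> is dominated by a multiple of the indicator of \<open>K'\<close>.\<close>
    have "integrable lborel (\<lambda>x. h (dil \<nu> (exp (s n)) x))"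
    proof -
      have "integrable lborel (\<lambda>x. s n * u n x + h x)"
        by (intro Bochner_Integration.integrable_add integrable_mult_right h
            Bochner_Integration.integrable_bound[OF intM mu] AE_I2)
          (use bound in \<open>auto intro: order_trans[OF _ abs_ge_self]\<close>)
      then show ?thesis using s(1)[of n] by (simp add: u_def)
    qed
    then show ?thesis
      unfolding u_def using h lborel_integral_dil[OF mh, of \<nu> "s n"] by (simp add: algebra_simps)
  qed
  moreover have "(\<lambda>n. (exp (- hom_dim \<nu> * s n) - 1) / s n) \<longlonglongrightarrow> - hom_dim \<nu>"
  proof -
    have "((\<lambda>t. exp (- hom_dim \<nu> * t)) has_real_derivative - hom_dim \<nu>) (at 0)"
      by (auto intro!: derivative_eq_intros)
    then have "((\<lambda>t. (exp (- hom_dim \<nu> * t) - 1) / t) \<longlongrightarrow> - hom_dim \<nu>) (at 0)"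
      by (simp add: DERIV_def)
    moreover have "filterlim s (at 0) sequentially"
      using s_lim s(1) by (auto simp: filterlim_at intro!: always_eventually) (metis less_irrefl)
    ultimately show ?thesis by (rule filterlim_compose)
  qed
  ultimately have "(\<lambda>n. (exp (- hom_dim \<nu> * s n) - 1) / s n * integral\<^sup>L lborel h) \<longlonglongrightarrow> integral\<^sup>L lborel D"
    and "(\<lambda>n. (exp (- hom_dim \<nu> * s n) - 1) / s n * integral\<^sup>L lborel h) \<longlonglongrightarrow> - hom_dim \<nu> * integral\<^sup>L lborel h"
    by (simp_all only: tendsto_mult_right)
  then show "integral\<^sup>L lborel D = - hom_dim \<nu> * integral\<^sup>L lborel h"
    by (rule LIMSEQ_unique)
qed

section \<open>The remainder functional\<close>

text \<open>Away from zeros, write |z|^p as (|z|^2)^(p/2). At a zero the modulus of the difference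
  quotient of |z|^p is that of z times |z|^(p-1), which tends to 0 because p > 1; the formula also
  gives 0 there, since its last factor contains \<open>z t\<close>.\<close>

lemma has_real_derivative_cmod_powr:
  fixes z :: "real \<Rightarrow> complex"
  assumes z: "(z has_vector_derivative z') (at t)" and p: "1 < p"
  shows "((\<lambda>t. cmod (z t) powr p) has_real_derivative
      p * cmod (z t) powr (p - 2) * Re (z t * cnj z')) (at t)"
proof (cases "z t = 0")
  case False
  have sq: "(Re (z t))\<^sup>2 + (Im (z t))\<^sup>2 > 0"
    using False by (simp add: complex_eq_iff sum_power2_gt_zero_iff)
  have Re: "((\<lambda>t. Re (z t)) has_real_derivative Re z') (at t)"
    and Im: "((\<lambda>t. Im (z t)) has_real_derivative Im z') (at t)"
    using z by (simp_all add: has_vector_derivative_complex_iff)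
  have "((\<lambda>t. (Re (z t))\<^sup>2 + (Im (z t))\<^sup>2) has_real_derivative
      2 * Re (z t) * Re z' + 2 * Im (z t) * Im z') (at t)"
    using DERIV_add[OF DERIV_power[OF Re, of 2] DERIV_power[OF Im, of 2]] by (simp add: algebra_simps)
  from DERIV_fun_powr[OF this sq, of "p/2"]
  have "((\<lambda>t. ((Re (z t))\<^sup>2 + (Im (z t))\<^sup>2) powr (p/2)) has_real_derivative
      p * ((Re (z t))\<^sup>2 + (Im (z t))\<^sup>2) powr (p/2 - 1) * Re (z t * cnj z')) (at t)"
    by (rule DERIV_cong) (simp add: field_simps)
  moreover have "((Re w)\<^sup>2 + (Im w)\<^sup>2) powr a = cmod w powr (2 * a)" for w a
    by (simp add: cmod_power2[symmetric] powr_powr[symmetric] powr_numeral)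
  ultimately show ?thesis
    by (simp add: right_diff_distrib)
next
  case True
  have "((\<lambda>s. Re ((z s - z t) / of_real (s - t))) \<longlongrightarrow> Re z') (at t)"
    and "((\<lambda>s. Im ((z s - z t) / of_real (s - t))) \<longlongrightarrow> Im z') (at t)"
    using z by (simp_all add: has_vector_derivative_complex_iff has_field_derivative_iff)
  then have "((\<lambda>s. (z s - z t) / of_real (s - t)) \<longlongrightarrow> z') (at t)"
    by (simp add: tendsto_complex_iff)
  moreover have "((\<lambda>s. cmod (z s) powr (p - 1)) \<longlongrightarrow> 0) (at t)"
  proof -
    have "(z \<longlongrightarrow> 0) (at t)"
      using has_vector_derivative_continuous[OF z] True by (simp add: continuous_at)
    then have "((\<lambda>s. cmod (z s)) \<longlongrightarrow> 0) (at t)" by (rule tendsto_norm_zero)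
    from tendsto_powr'[OF this tendsto_const, of "p - 1"] show ?thesis using p by simp
  qed
  ultimately have "((\<lambda>s. cmod ((z s - z t) / of_real (s - t)) * cmod (z s) powr (p - 1)) \<longlongrightarrow> cmod z' * 0) (at t)"
    by (intro tendsto_mult tendsto_norm)
  moreover have "cmod ((z s - z t) / of_real (s - t)) * cmod (z s) powr (p - 1)
      = \<bar>(cmod (z s) powr p - cmod (z t) powr p) / (s - t)\<bar>" for s
  proof (cases "z s = 0")
    case False
    then have "cmod (z s) * cmod (z s) powr (p - 1) = cmod (z s) powr p"
      by (simp add: powr_mult_base)
    then show ?thesis using True by (simp add: norm_divide abs_divide flip: of_real_diff)
  qed (use True in simp)
  ultimately have "((\<lambda>s. (cmod (z s) powr p - cmod (z t) powr p) / (s - t)) \<longlongrightarrow> 0) (at t)"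
    by (simp only: mult_zero_right) (rule tendsto_rabs_zero_cancel)
  then show ?thesis using True by (simp add: has_field_derivative_iff)
qed

text \<open>Strict convexity of the power, through the mean value theorem and strict monotonicity of
  the exponent \<open>p - 1\<close>. The point \<open>a = 0\<close>, where the derivative formula
  for \<open>powr\<close> is not at hand, is computed directly.\<close>

lemma powr_gt_tangent:
  fixes a s p :: real
  assumes "0 \<le> a" "0 < s" "1 < p" "a \<noteq> s"
  shows "s powr p + p * s powr (p - 1) * (a - s) < a powr p"
proof (cases "a = 0")
  case True
  have "s powr (p - 1) * s = s powr p"
    using assms(2) by (simp add: powr_mult_base mult.commute)
  then have "s powr p + p * s powr (p - 1) * (a - s) = (1 - p) * s powr p"
    using True by (simp add: algebra_simps)
  also have "\<dots> < 0" using assms by (simp add: mult_neg_pos)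
  finally show ?thesis using True by simp
next
  case False
  have D: "((\<lambda>x. x powr p) has_real_derivative p * x powr (p - 1)) (at x)" if "0 < x" for x
    using that by (auto intro!: derivative_eq_intros)
  consider "a < s" | "s < a" using assms(4) by linarith
  then show ?thesis
  proof cases
    case 1
    then obtain z where z: "a < z" "z < s" "s powr p - a powr p = (s - a) * (p * z powr (p - 1))"
      using MVT2[OF 1, of "\<lambda>x. x powr p" "\<lambda>x. p * x powr (p - 1)"] D assms(1) False by force
    have "z powr (p - 1) < s powr (p - 1)"
      using z assms by (intro powr_less_mono2) auto
    then have "(s - a) * (p * z powr (p - 1)) < (s - a) * (p * s powr (p - 1))"
      using 1 assms by simp
    with z show ?thesis by (simp add: algebra_simps)
  next
    case 2
    then obtain z where z: "s < z" "z < a" "a powr p - s powr p = (a - s) * (p * z powr (p - 1))"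
      using MVT2[OF 2, of "\<lambda>x. x powr p" "\<lambda>x. p * x powr (p - 1)"] D assms(2) by force
    have "s powr (p - 1) < z powr (p - 1)"
      using z assms by (intro powr_less_mono2) auto
    then have "(a - s) * (p * s powr (p - 1)) < (a - s) * (p * z powr (p - 1))"
      using 2 assms by simp
    with z show ?thesis by (simp add: algebra_simps)
  qed
qed

text \<open>For \<xi> = \<eta> both subtracted terms vanish because \<open>0 powr a = 0\<close>, so
  one formula covers the two branches.\<close>

lemma Cp_eq:
  "Cp p \<xi> \<eta> = cmod \<xi> powr p - cmod (\<xi> - \<eta>) powr p
     - p * cmod (\<xi> - \<eta>) powr (p - 2) * Re ((\<xi> - \<eta>) * cnj \<eta>)"
  by (simp add: Cp_def)

text \<open>With s = |\<xi> - \<eta>| and a = |\<xi>|, the functional splits into the convexity gap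
  a^p - s^p - p s^(p-1) (a - s) and p s^(p-2) times the Cauchy-Schwarz gap s a - Re((\<xi> - \<eta>)
  cnj \<xi>). If both gaps close, then a = s and \<xi> - \<eta> is a positive multiple of \<xi>, so
  \<eta> = 0.\<close>

lemma Cp_pos:
  assumes "1 < p" "\<eta> \<noteq> 0"
  shows "0 < Cp p \<xi> \<eta>"
proof (cases "\<xi> = \<eta>")
  case True
  then show ?thesis using assms by (simp add: Cp_def)
next
  case False
  define s a where "s = cmod (\<xi> - \<eta>)" and "a = cmod \<xi>"
  have s: "0 < s" and a: "0 \<le> a" using False by (auto simp: s_def a_def)
  have sq: "s * s = Re ((\<xi> - \<eta>) * cnj (\<xi> - \<eta>))"
    by (simp only: s_def power2_eq_square[symmetric] cmod_power2) (simp add: power2_eq_square algebra_simps)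
  have eq: "Re ((\<xi> - \<eta>) * cnj \<eta>) = Re ((\<xi> - \<eta>) * cnj \<xi>) - s * s"
    by (simp add: sq algebra_simps)
  have le: "Re ((\<xi> - \<eta>) * cnj \<xi>) \<le> s * a"
    using complex_Re_le_cmod[of "(\<xi> - \<eta>) * cnj \<xi>"] by (simp add: norm_mult s_def a_def)
  have sp: "s powr (p - 2) * s = s powr (p - 1)"
    using s by (simp add: powr_mult_base mult.commute)
  have lower: "Cp p \<xi> \<eta> = a powr p - (s powr p + p * s powr (p - 1) * (a - s))
      + p * s powr (p - 2) * (s * a - Re ((\<xi> - \<eta>) * cnj \<xi>))"
    unfolding Cp_eq eq sp[symmetric] s_def[symmetric] a_def[symmetric] by (simp add: algebra_simps)
  show ?thesis
  proof (cases "a = s")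
    case False
    moreover have "0 \<le> p * s powr (p - 2) * (s * a - Re ((\<xi> - \<eta>) * cnj \<xi>))"
      using assms le by simp
    ultimately show ?thesis
      using powr_gt_tangent[OF a s assms(1) False] lower by linarith
  next
    case True
    have "Re ((\<xi> - \<eta>) * cnj \<xi>) \<noteq> s * a"
    proof
      assume "Re ((\<xi> - \<eta>) * cnj \<xi>) = s * a"
      then have "Re ((\<xi> - \<eta>) * cnj \<eta>) = 0" using eq True by simp
      \<comment> \<open>Pythagoras: \<xi> is the sum of \<xi> - \<eta> and \<eta>, which are now
        orthogonal, while \<xi> and \<xi> - \<eta> have equal length.\<close>
      moreover have "(cmod \<xi>)\<^sup>2 = (cmod (\<xi> - \<eta>))\<^sup>2 + 2 * Re ((\<xi> - \<eta>) * cnj \<eta>) + (cmod \<eta>)\<^sup>2"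
        by (simp only: cmod_power2) (simp add: power2_eq_square algebra_simps)
      ultimately have "cmod \<eta> = 0" using True by (simp add: s_def a_def)
      with assms show False by simp
    qed
    with le have "0 < p * s powr (p - 2) * (s * a - Re ((\<xi> - \<eta>) * cnj \<xi>))"
      using assms s by simp
    then show ?thesis using lower True by simp
  qed
qed

lemma Cp_nonneg: "1 < p \<Longrightarrow> 0 \<le> Cp p \<xi> \<eta>"
  using Cp_pos[of p \<eta> \<xi>] by (cases "\<eta> = 0") (auto simp: Cp_eq)

lemma Cp_scale:
  assumes "0 \<le> c"
  shows "Cp p (of_real c * \<xi>) (of_real c * \<eta>) = c powr p * Cp p \<xi> \<eta>"
proof (cases "c = 0")
  case False
  then have c: "c > 0" using assms by simp
  have n: "cmod (of_real c * \<xi> - of_real c * \<eta>) = c * cmod (\<xi> - \<eta>)"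
    using c by (simp add: norm_mult flip: right_diff_distrib)
  have r: "Re ((of_real c * \<xi> - of_real c * \<eta>) * cnj (of_real c * \<eta>)) = c * c * Re ((\<xi> - \<eta>) * cnj \<eta>)"
    by (simp add: algebra_simps)
  have "c powr (p - 2) * (c * c) = c powr p"
    using c by (simp add: powr_diff powr_numeral power2_eq_square)
  then have key: "p * (c * d) powr (p - 2) * (c * c * y) = c powr p * (p * d powr (p - 2) * y)" if "0 \<le> d" for d y
    using c that by (simp add: powr_mult)
  show ?thesis
    unfolding Cp_eq n r key[OF norm_ge_zero] using c by (simp add: norm_mult powr_mult right_diff_distrib)
qed (simp add: Cp_def)

section \<open>Homogeneous quasi-norms and the radial derivative\<close>

text \<open>The estimates live on the orbits of the dilations; the locale records the facts about
  \<open>dil\<close> and \<open>q\<close> that they rest on.\<close>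

locale homogeneous_norm =
  fixes \<nu> :: "'n::finite \<Rightarrow> real" and q :: "real^'n \<Rightarrow> real"
  assumes nu_pos: "\<And>i. 0 < \<nu> i"
    and q_cont: "continuous_on UNIV q"
    and q_nonneg: "\<And>x. 0 \<le> q x"
    and q_dil: "\<And>r x. 0 < r \<Longrightarrow> q (dil \<nu> r x) = r * q x"
    and q_eq_0: "\<And>x. q x = 0 \<longleftrightarrow> x = 0"
begin

lemma q_measurable [measurable]: "q \<in> borel_measurable borel"
  using q_cont by (rule borel_measurable_continuous_onI)

definition euler_deriv :: "(real^'n \<Rightarrow> complex) \<Rightarrow> real^'n \<Rightarrow> complex" where
  "euler_deriv f x = frechet_derivative f (at x) (euler_field \<nu> x)"

lemma euler_deriv_flow:
  assumes "f differentiable at (dil \<nu> (exp t) x)"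
  shows "((\<lambda>t. f (dil \<nu> (exp t) x)) has_vector_derivative euler_deriv f (dil \<nu> (exp t) x)) (at t)"
proof -
  have "(f has_derivative frechet_derivative f (at (dil \<nu> (exp t) x))) (at (dil \<nu> (exp t) x))"
    using assms frechet_derivative_works by blast
  from vector_derivative_diff_chain_within[OF dil_exp_has_vector_derivative
      has_derivative_at_withinI[OF this, of "range (\<lambda>t. dil \<nu> (exp t) x)"]]
  show ?thesis
    by (simp add: euler_deriv_def o_def)
qed

text \<open>The ray through x is its dilation orbit with parameter r = exp t, so d/dr is 1/r times
  the derivative in t. At the origin the orbit is constant and division by \<open>q 0 = 0\<close>
  also yields 0.\<close>

lemma radial_deriv_eq:
  assumes f: "f differentiable at x"
  shows "radial_deriv \<nu> q f x = euler_deriv f x / of_real (q x)"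
proof (cases "x = 0")
  case True
  have "dil \<nu> r (0::real^'n) = 0" for r by (simp add: dil_def vec_eq_iff)
  moreover have "vector_derivative (\<lambda>_. f 0) (at (0::real)) = 0"
    by (rule vector_derivative_at) simp
  moreover have "q 0 = 0" using q_eq_0[of 0] by simp
  ultimately show ?thesis
    using True by (simp add: radial_deriv_def)
next
  case False
  then have qx: "0 < q x" using q_nonneg[of x] q_eq_0[of x] by linarith
  have *: "dil \<nu> (exp (ln r)) (dil \<nu> (1 / q x) x) = dil \<nu> r (dil \<nu> (1 / q x) x)" if "0 < r" for r
    using that by simp
  have x: "dil \<nu> (exp (ln (q x))) (dil \<nu> (1 / q x) x) = x"
    using qx by (simp add: dil_dil dil_1)
  have "((\<lambda>t. f (dil \<nu> (exp t) (dil \<nu> (1 / q x) x))) has_vector_derivative euler_deriv f x) (at (ln (q x)))"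
    using euler_deriv_flow[of f "ln (q x)" "dil \<nu> (1 / q x) x"] f by (simp only: x)
  moreover have "(ln has_vector_derivative 1 / q x) (at (q x))"
    using DERIV_ln_divide[OF qx] by (simp add: has_real_derivative_iff_has_vector_derivative)
  ultimately have "((\<lambda>r. f (dil \<nu> (exp (ln r)) (dil \<nu> (1 / q x) x))) has_vector_derivative
      (1 / q x) *\<^sub>R euler_deriv f x) (at (q x))"
    using vector_diff_chain_at[of ln "1 / q x" "q x"] by (simp add: o_def)
  then have "((\<lambda>r. f (dil \<nu> r (dil \<nu> (1 / q x) x))) has_vector_derivative
      (1 / q x) *\<^sub>R euler_deriv f x) (at (q x))"
    by (rule has_vector_derivative_transform_within_open[where S = "{0<..}"]) (use qx in auto)
  then show ?thesis
    by (simp add: radial_deriv_def vector_derivative_at scaleR_conv_of_real divide_inverse)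
qed

lemma logw_dil:
  assumes "0 < R" "0 < q x"
  shows "logw q R (dil \<nu> (exp t) x) = logw q R x - t"
  using assms by (simp add: logw_def q_dil ln_div ln_mult)

lemma logw_pos: "0 < q x \<Longrightarrow> q x < R \<Longrightarrow> 0 < logw q R x"
  by (simp add: logw_def)

lemma continuous_on_logw: "continuous_on {x. 0 < q x \<and> q x < R} (logw q R)"
  unfolding logw_def
  by (intro continuous_intros continuous_on_subset[OF q_cont]) auto

lemma continuous_on_weight:
  "continuous_on {x. 0 < q x \<and> q x < R} (\<lambda>x. q x powr a * logw q R x powr b)"
  by (intro continuous_intros continuous_on_logw continuous_on_subset[OF q_cont])
    (use logw_pos in force)+

lemma weight_measurable [measurable]:
  "(\<lambda>x. q x powr a * logw q R x powr b) \<in> borel_measurable borel"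
  unfolding logw_def by measurable

lemma test_fun_support:
  assumes "test_fun q R f"
  obtains K where "compact K" "K \<subseteq> {x. 0 < q x \<and> q x < R}" "\<And>x. x \<notin> K \<Longrightarrow> f x = 0"
    "\<And>x. x \<notin> K \<Longrightarrow> euler_deriv f x = 0" "\<And>x. f differentiable at x"
    "continuous_on UNIV f" "continuous_on UNIV (euler_deriv f)"
proof
  define K where "K = closure {x. f x \<noteq> 0}"
  have smooth: "smooth_fun f" and K: "compact K" "K \<subseteq> {x. q x < R} - {0}"
    using assms unfolding K_def test_fun_def by blast+
  have "0 < q x \<and> q x < R" if "x \<in> K" for x
  proof -
    have "q x \<noteq> 0" "q x < R" using that K(2) q_eq_0[of x] by blast+
    then show ?thesis using q_nonneg[of x] by linarith
  qed
  then show "K \<subseteq> {x. 0 < q x \<and> q x < R}" by blast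
  show "compact K" by fact
  show f0: "f x = 0" if "x \<notin> K" for x
    using that closure_subset[of "{x. f x \<noteq> 0}"] unfolding K_def by blast
  have diff: "iter_dirderiv f vs differentiable at x" for vs x
    using smooth by (simp add: smooth_fun_def)
  show f: "f differentiable at x" for x using diff[of "[]"] by simp
  show "continuous_on UNIV f"
    using f by (auto intro!: continuous_at_imp_continuous_on differentiable_imp_continuous_within)
  show "euler_deriv f x = 0" if "x \<notin> K" for x
  proof -
    have "open (- K)" by (simp add: K_def open_Compl)
    from has_derivative_transform_within_open[OF has_derivative_const[of 0] this, of x f]
    have "(f has_derivative (\<lambda>_. 0)) (at x)"
      using that f0 by (metis ComplI ComplD)
    from frechet_derivative_at[OF this, symmetric] show ?thesis
      by (simp add: euler_deriv_def)
  qed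
  \<comment> \<open>In coordinates the Euler derivative is a finite sum of first partial derivatives
    with linear coefficients; continuity of each summand is then available from
    \<open>smooth_fun\<close>.\<close>
  have "euler_deriv f x = (\<Sum>i\<in>UNIV. (\<nu> i * x $ i) *\<^sub>R iter_dirderiv f [axis i 1] x)" for x
  proof -
    have lin: "linear (frechet_derivative f (at x))"
      by (rule linear_frechet_derivative[OF f])
    have "euler_field \<nu> x = (\<Sum>i\<in>UNIV. (\<nu> i * x $ i) *\<^sub>R axis i 1)"
      by (simp add: euler_field_def vec_eq_iff axis_nth_if if_distrib sum.delta' cong: if_cong)
    then show ?thesis
      by (simp add: euler_deriv_def dirderiv_def linear_sum[OF lin] linear_scale[OF lin])
  qed
  moreover have "continuous_on UNIV (iter_dirderiv f vs)" for vs
    using diff by (auto intro!: continuous_at_imp_continuous_on differentiable_imp_continuous_within)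
  ultimately have "continuous_on UNIV (\<lambda>x. euler_deriv f x)"
    by (simp only:) (intro continuous_intros)
  then show "continuous_on UNIV (euler_deriv f)" .
qed

text \<open>Vanishing off \<open>K\<close> absorbs the restriction to the ball, and a Borel
  integrand has the same integral for the completed measure.\<close>

lemma wint_eq_lborel:
  assumes K: "compact K" "K \<subseteq> {x. 0 < q x \<and> q x < R}"
    and g: "g \<in> borel_measurable borel" "\<And>x. x \<notin> K \<Longrightarrow> g x = 0"
  shows "wint q R a b g = (LBINT x. g x / (q x powr a * logw q R x powr b))"
proof -
  have "wint q R a b g = (LINT x|lebesgue. g x / (q x powr a * logw q R x powr b))"
    unfolding wint_def set_lebesgue_integral_def
    using K(2) g(2) by (intro Bochner_Integration.integral_cong) (auto simp: indicator_def)
  also have "\<dots> = (LBINT x. g x / (q x powr a * logw q R x powr b))"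
    by (intro integral_completion borel_measurable_divide) (use g(1) weight_measurable in simp_all)
  finally show ?thesis .
qed

lemma integrable_weighted:
  fixes g :: "real^'n \<Rightarrow> real"
  assumes K: "compact K" "K \<subseteq> {x. 0 < q x \<and> q x < R}"
    and g: "continuous_on K g" "\<And>x. x \<notin> K \<Longrightarrow> g x = 0"
  shows "integrable lborel (\<lambda>x. g x / (q x powr a * logw q R x powr b))"
proof (rule integrable_lborel_compact_support[OF K(1)])
  have "q x powr a * logw q R x powr b \<noteq> 0" if "x \<in> K" for x
    using that K(2) logw_pos[of x R] by auto
  then show "continuous_on K (\<lambda>x. g x / (q x powr a * logw q R x powr b))"
    by (intro continuous_intros g continuous_on_subset[OF continuous_on_weight K(2)]) auto
qed (simp add: g(2))

end

section \<open>Pointwise expansion of the weighted remainder\<close>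

lemma continuous_on_cmod_powr:
  assumes "continuous_on S g" "0 < a"
  shows "continuous_on S (\<lambda>x. cmod (g x) powr a)"
  using assms by (intro continuous_on_powr' continuous_intros) auto

text \<open>Both sides are 0 at \<open>k = 0\<close>, which keeps \<beta> = -p inside the general
  computation.\<close>

lemma abs_powr_diff_two_mult_square: "\<bar>k\<bar> powr (p - 2) * (k * k) = \<bar>k\<bar> powr p" for k p :: real
proof (cases "k = 0")
  case False
  then have "\<bar>k\<bar> powr (p - 2) * (\<bar>k\<bar> * \<bar>k\<bar>) = \<bar>k\<bar> powr p"
    by (simp add: powr_diff powr_numeral power2_eq_square)
  then show ?thesis by (simp only: abs_mult_self_eq)
qed simp

text \<open>Here the difference of the arguments is -(k/L) f. The power term contributes -1 and the
  quadratic part of the cross term +p to the coefficient of |k f/L|^p, hence \<open>p - 1\<close>.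
  What remains of the cross term contains p |f|^(p-2) Re(f cnj e), which is the Euler derivative of
  |f|^p once e is that of f.\<close>

lemma Cp_shift:
  fixes e f :: complex and k L p :: real
  assumes L: "0 < L"
  shows "Cp p e (e + of_real k * f / of_real L) = cmod e powr p + (p - 1) * \<bar>k\<bar> powr p * cmod f powr p / L powr p
    + k * \<bar>k\<bar> powr (p - 2) * (p * cmod f powr (p - 2) * Re (f * cnj e)) / L powr (p - 1)"
proof -
  have d: "e - (e + of_real k * f / of_real L) = - (of_real k * f / of_real L)" by simp
  have n: "cmod (- (of_real k * f / of_real L)) powr a = \<bar>k\<bar> powr a * cmod f powr a / L powr a" for a
    using L by (simp add: norm_mult norm_divide powr_mult powr_divide)
  have "Re (- (of_real k * f / of_real L) * cnj (e + of_real k * f / of_real L))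
      = - (k / L) * Re (f * cnj e) - (k / L) * (k / L) * (cmod f * cmod f)"
    unfolding power2_eq_square[symmetric] cmod_power2
    by (simp add: power2_eq_square algebra_simps add_divide_distrib)
  note re = this
  have "Cp p e (e + of_real k * f / of_real L)
      = cmod e powr p - \<bar>k\<bar> powr p * cmod f powr p / L powr p
        + p * (\<bar>k\<bar> powr (p - 2) * (k * k)) * (cmod f powr (p - 2) * (cmod f * cmod f)) / (L powr (p - 2) * (L * L))
        + k * \<bar>k\<bar> powr (p - 2) * (p * cmod f powr (p - 2) * Re (f * cnj e)) / (L powr (p - 2) * L)"
    unfolding Cp_eq d n re
    by (simp add: algebra_simps diff_divide_distrib add_divide_distrib del: times_complex.sel)
  moreover have "cmod f powr (p - 2) * (cmod f * cmod f) = cmod f powr p"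
    using abs_powr_diff_two_mult_square[of "cmod f" p] by simp
  moreover have "L powr (p - 2) * (L * L) = L powr p"
    using abs_powr_diff_two_mult_square[of L p] L by simp
  moreover have "L powr (p - 2) * L = L powr (p - 1)"
    using L by (simp add: powr_mult_base mult.commute)
  ultimately show ?thesis
    by (simp only: abs_powr_diff_two_mult_square) (simp add: left_diff_distrib diff_divide_distrib)
qed

text \<open>The factor 1/r in the radial derivative makes the powers of r in the two arguments
  agree, so both are the scalar \<open>c\<close> times the arguments of \<open>Cp_shift\<close>;
  homogeneity then pulls out \<open>c powr p\<close>.\<close>

lemma Cp_weighted:
  fixes e f :: complex and r L p \<alpha> \<beta> k :: real
  assumes r: "0 < r" and L: "0 < L" and p: "1 < p"
  defines "\<xi> \<equiv> e / of_real r / of_real (r powr (\<alpha> / p) * L powr ((\<beta> + 1) / p))"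
  shows "Cp p \<xi> (\<xi> + of_real k * f / of_real (r powr ((\<alpha> + p) / p) * L powr ((\<beta> + p + 1) / p)))
    = cmod e powr p / (r powr (\<alpha> + p) * L powr (\<beta> + 1))
      + (p - 1) * \<bar>k\<bar> powr p * (cmod f powr p / (r powr (\<alpha> + p) * L powr (\<beta> + p + 1)))
      + k * \<bar>k\<bar> powr (p - 2) * (p * cmod f powr (p - 2) * Re (f * cnj e) / (r powr (\<alpha> + p) * L powr (\<beta> + p)))"
proof -
  define c where "c = 1 / (r powr ((\<alpha> + p) / p) * L powr ((\<beta> + 1) / p))"
  have c: "0 \<le> c" by (simp add: c_def)
  have r1: "r powr ((\<alpha> + p) / p) = r * r powr (\<alpha> / p)"
    using r p by (simp add: add_divide_distrib powr_add)
  have L1: "L powr ((\<beta> + p + 1) / p) = L * L powr ((\<beta> + 1) / p)"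
    using L p by (simp add: add_divide_distrib powr_add)
  have cp: "c powr p = 1 / (r powr (\<alpha> + p) * L powr (\<beta> + 1))"
    using p by (simp add: c_def powr_divide powr_mult powr_powr)
  have xi: "\<xi> = of_real c * e"
    by (simp add: \<xi>_def c_def r1 divide_simps)
  have "\<xi> + of_real k * f / of_real (r powr ((\<alpha> + p) / p) * L powr ((\<beta> + p + 1) / p))
      = of_real c * (e + of_real k * f / of_real L)"
    unfolding xi L1 by (simp add: c_def distrib_left)
  then have "Cp p \<xi> (\<xi> + of_real k * f / of_real (r powr ((\<alpha> + p) / p) * L powr ((\<beta> + p + 1) / p)))
      = c powr p * Cp p e (e + of_real k * f / of_real L)"
    by (simp only: xi Cp_scale[OF c])
  moreover have "L powr (\<beta> + p + 1) = L powr (\<beta> + 1) * L powr p"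
    by (simp add: powr_add[symmetric] algebra_simps)
  moreover have "L powr (\<beta> + p) = L powr (\<beta> + 1) * L powr (p - 1)"
    by (simp add: powr_add[symmetric] algebra_simps)
  ultimately show ?thesis
    unfolding cp Cp_shift[OF L] by (simp add: distrib_left del: complex_cnj_mult times_complex.sel)
qed

section \<open>The integral identity\<close>

context homogeneous_norm
begin

text \<open>Along an orbit the quasi-norm is multiplied by \<open>exp t\<close> and
  \<open>logw\<close> decreases with unit speed. So the weight is differentiable in this direction
  although \<open>q\<close> is merely continuous, and the \<open>b\<close> term gets a plus
  sign.\<close>

lemma weighted_flow_derivative:
  assumes R: "0 < R" and p: "1 < p" and f: "f differentiable at x" and x: "0 < q x" "q x < R"
  shows "((\<lambda>t. cmod (f (dil \<nu> (exp t) x)) powr p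
        / (q (dil \<nu> (exp t) x) powr a * logw q R (dil \<nu> (exp t) x) powr b)) has_real_derivative
      p * cmod (f x) powr (p - 2) * Re (f x * cnj (euler_deriv f x)) / (q x powr a * logw q R x powr b)
      - a * (cmod (f x) powr p / (q x powr a * logw q R x powr b))
      + b * (cmod (f x) powr p / (q x powr a * logw q R x powr (b + 1)))) (at 0)"
proof -
  have L: "0 < logw q R x" using x by (rule logw_pos)
  have d: "dil \<nu> (exp 0) x = x" by (simp add: dil_1)
  have "((\<lambda>t. f (dil \<nu> (exp t) x)) has_vector_derivative euler_deriv f x) (at 0)"
    using euler_deriv_flow[of f 0 x] f by (simp only: d)
  from has_real_derivative_cmod_powr[OF this p]
  have 1: "((\<lambda>t. cmod (f (dil \<nu> (exp t) x)) powr p) has_real_derivative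
      p * cmod (f x) powr (p - 2) * Re (f x * cnj (euler_deriv f x))) (at 0)"
    by (simp only: d)
  have 2: "((\<lambda>t. (exp t * q x) powr (- a)) has_real_derivative (- a) * q x powr (- a)) (at 0)"
    using x by (auto intro!: derivative_eq_intros simp: powr_diff)
  have 3: "((\<lambda>t. (logw q R x - t) powr (- b)) has_real_derivative b * logw q R x powr (- (b + 1))) (at 0)"
    using L by (auto intro!: derivative_eq_intros)
  have eq: "(\<lambda>t. cmod (f (dil \<nu> (exp t) x)) powr p
        / (q (dil \<nu> (exp t) x) powr a * logw q R (dil \<nu> (exp t) x) powr b))
      = (\<lambda>t. cmod (f (dil \<nu> (exp t) x)) powr p * ((exp t * q x) powr (- a) * (logw q R x - t) powr (- b)))"
    using R x by (simp add: q_dil logw_dil powr_minus divide_inverse)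
  show ?thesis
    unfolding eq
    by (rule DERIV_cong[OF DERIV_mult[OF 1 DERIV_mult[OF 2 3]]])
      (simp only: d exp_zero mult_1 diff_zero powr_minus divide_inverse inverse_mult_distrib, simp add: dil_1 algebra_simps)
qed

lemma remainder_identity:
  fixes \<alpha> \<beta> :: real
  assumes R: "0 < R" and p: "1 < p" and f: "test_fun q R f"
  defines "\<kappa> \<equiv> (\<beta> + p) / p"
  defines "C \<equiv> \<lambda>x. Cp p (xi_fun \<nu> q R \<alpha> \<beta> p f x) (eta_fun \<nu> q R \<alpha> \<beta> p f x)"
  shows "set_integrable lebesgue {x. q x < R} C"
    and "(LINT x:{x. q x < R}|lebesgue. C x)
      = wint q R \<alpha> (\<beta> + 1) (\<lambda>x. cmod (radial_deriv \<nu> q f x) powr p)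
        - \<bar>\<kappa>\<bar> powr p * wint q R (\<alpha> + p) (\<beta> + p + 1) (\<lambda>x. cmod (f x) powr p)
        - (hom_dim \<nu> - \<alpha> - p) * \<kappa> * \<bar>\<kappa>\<bar> powr (p - 2) * wint q R (\<alpha> + p) (\<beta> + p) (\<lambda>x. cmod (f x) powr p)"
proof -
  obtain K where K: "compact K" "K \<subseteq> {x. 0 < q x \<and> q x < R}" and f0: "\<And>x. x \<notin> K \<Longrightarrow> f x = 0"
    and e0: "\<And>x. x \<notin> K \<Longrightarrow> euler_deriv f x = 0" and df: "\<And>x. f differentiable at x"
    and cf: "continuous_on UNIV f" and ce: "continuous_on UNIV (euler_deriv f)"
    using test_fun_support[OF f] by metis
  define F where "F x = cmod (f x) powr p" for x
  define T where "T x = p * cmod (f x) powr (p - 2) * Re (f x * cnj (euler_deriv f x))" for x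
  define w where "w b x = q x powr (\<alpha> + p) * logw q R x powr b" for b x
  define D where "D x = T x / w (\<beta> + p) x - (\<alpha> + p) * (F x / w (\<beta> + p) x)
    + (\<beta> + p) * (F x / w (\<beta> + p + 1) x)" for x
  have cF: "continuous_on S F" for S
    unfolding F_def using p by (intro continuous_on_cmod_powr continuous_on_subset[OF cf]) auto
  have F0: "F x = 0" if "x \<notin> K" for x using f0[OF that] by (simp add: F_def)
  have T0: "T x = 0" if "x \<notin> K" for x using f0[OF that] by (simp add: T_def)
  have D0: "D x = 0" if "x \<notin> K" for x using F0 T0 that by (simp add: D_def)
  have iF: "integrable lborel (\<lambda>x. F x / w b x)" for b
    unfolding w_def by (rule integrable_weighted[OF K cF F0])
  have w_pos: "w b x > 0" if "x \<in> K" for b x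
    using that K(2) logw_pos[of x R] by (auto simp: w_def)
  \<comment> \<open>For p < 2 the factor |f|^(p-2) is singular near zeros of f. One factor |f| from
    the real part raises the exponent to p - 1 > 0, which gives a continuous majorant.\<close>
  have "\<bar>T x\<bar> \<le> p * cmod (f x) powr (p - 1) * cmod (euler_deriv f x)" for x
  proof -
    have "\<bar>Re (f x * cnj (euler_deriv f x))\<bar> \<le> cmod (f x) * cmod (euler_deriv f x)"
      using abs_Re_le_cmod[of "f x * cnj (euler_deriv f x)"] by (simp add: norm_mult)
    then have "\<bar>T x\<bar> \<le> p * cmod (f x) powr (p - 2) * (cmod (f x) * cmod (euler_deriv f x))"
      unfolding T_def using p by (simp add: abs_mult mult_left_mono)
    moreover have "cmod (f x) powr (p - 2) * cmod (f x) = cmod (f x) powr (p - 1)"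
      by (cases "f x = 0") (simp_all add: powr_mult_base mult.commute)
    ultimately show ?thesis by (metis mult.assoc)
  qed
  note T_bound = this
  \<comment> \<open>A continuous majorant of \<open>D\<close> supported in \<open>K\<close>; it
    supplies the uniform bound that differentiation under the integral requires.\<close>
  define V where "V x = p * cmod (f x) powr (p - 1) * cmod (euler_deriv f x) / w (\<beta> + p) x
      + \<bar>\<alpha> + p\<bar> * (F x / w (\<beta> + p) x) + \<bar>\<beta> + p\<bar> * (F x / w (\<beta> + p + 1) x)" for x
  have cw: "continuous_on K (w b)" for b
    unfolding w_def by (rule continuous_on_subset[OF continuous_on_weight K(2)])
  have cV: "continuous_on K V"
    unfolding V_def using p w_pos
    by (intro continuous_on_add continuous_on_divide continuous_on_mult continuous_on_const continuous_on_norm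
        continuous_on_cmod_powr cw cF continuous_on_subset[OF cf] continuous_on_subset[OF ce])
       (auto simp: less_imp_neq[symmetric])
  have V0: "V x = 0" if "x \<notin> K" for x using F0 e0 that by (simp add: V_def)
  obtain M where M: "\<And>x. \<bar>V x\<bar> \<le> M"
    using bounded_by_compact_support[OF K(1) cV V0] by blast
  have D_bound: "\<bar>D x\<bar> \<le> M" for x
  proof (cases "x \<in> K")
    case True
    have "\<bar>T x / w (\<beta> + p) x\<bar> \<le> p * cmod (f x) powr (p - 1) * cmod (euler_deriv f x) / w (\<beta> + p) x"
      using T_bound[of x] w_pos[OF True, of "\<beta> + p"] by (simp add: abs_divide divide_right_mono)
    moreover have "\<bar>c * (F x / w b x)\<bar> = \<bar>c\<bar> * (F x / w b x)" for c b
      using w_pos[OF True, of b] by (simp add: abs_mult abs_divide F_def)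
    moreover have "\<bar>a - b + c\<bar> \<le> a' + b' + c'"
      if "\<bar>a\<bar> \<le> a'" "\<bar>b\<bar> = b'" "\<bar>c\<bar> = c'" for a b c a' b' c' :: real
      using that by linarith
    ultimately have "\<bar>D x\<bar> \<le> V x"
      unfolding D_def V_def by blast
    then show ?thesis using M[of x] by linarith
  qed (use D0 M[of x] in force)
  have D_deriv: "((\<lambda>t. F (dil \<nu> (exp t) x) / w (\<beta> + p) (dil \<nu> (exp t) x)) has_real_derivative D x) (at 0)" for x
  proof (cases "x \<in> K")
    case True
    then show ?thesis
      unfolding F_def w_def D_def T_def using K(2) by (intro weighted_flow_derivative R p df) auto
  next
    case False
    \<comment> \<open>A point off \<open>K\<close> stays off \<open>K\<close> for small times, so
      the density is locally zero along its orbit. This avoids differentiating the weight at the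
      origin or at the sphere.\<close>
    have "open (- K)" using K(1) compact_imp_closed by auto
    moreover have "continuous_on UNIV (\<lambda>t. dil \<nu> (exp t) x)"
      unfolding dil_exp by (intro continuous_intros)
    ultimately have "open ((\<lambda>t. dil \<nu> (exp t) x) -` (- K))"
      by (rule open_vimage)
    moreover have "0 \<in> (\<lambda>t. dil \<nu> (exp t) x) -` (- K)" using False by (simp add: dil_1)
    ultimately have "((\<lambda>t. F (dil \<nu> (exp t) x) / w (\<beta> + p) (dil \<nu> (exp t) x)) has_real_derivative 0) (at 0)"
      by (intro has_field_derivative_transform_within_open[OF DERIV_const]) (auto simp: F0)
    then show ?thesis using D0[OF False] by simp
  qed
  have D_int: "integrable lborel D"
    "integral\<^sup>L lborel D = - hom_dim \<nu> * (LBINT x. F x / w (\<beta> + p) x)"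
    using integral_euler_derivative[OF iF K(1) _ D_deriv D_bound] F0 by auto
  have iE: "integrable lborel (\<lambda>x. cmod (euler_deriv f x) powr p / w (\<beta> + 1) x)"
    unfolding w_def using p e0
    by (intro integrable_weighted[OF K]) (auto intro!: continuous_on_cmod_powr continuous_on_subset[OF ce])
  \<comment> \<open>The remainder with its cross term expressed through the total derivative
    \<open>D\<close>, whose integral is known.\<close>
  define G where "G x = cmod (euler_deriv f x) powr p / w (\<beta> + 1) x - \<bar>\<kappa>\<bar> powr p * (F x / w (\<beta> + p + 1) x)
    + \<kappa> * \<bar>\<kappa>\<bar> powr (p - 2) * (D x + (\<alpha> + p) * (F x / w (\<beta> + p) x))" for x
  have iG: "integrable lborel G"
    unfolding G_def
    by (intro Bochner_Integration.integrable_add Bochner_Integration.integrable_diff integrable_mult_right iE iF D_int)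
  have C_eq: "indicator {x. q x < R} x *\<^sub>R C x = G x" for x
  proof (cases "x \<in> K")
    case True
    then have x: "0 < q x" "q x < R" using K(2) by auto
    \<comment> \<open>Replacing \<open>T\<close> by \<open>D\<close> produces -p |\<kappa>|^p from
      the derivative of the logarithm; added to the (p - 1) |\<kappa>|^p of
      \<open>Cp_weighted\<close> it leaves -|\<kappa>|^p, the constant of the inequality.\<close>
    have "\<beta> + p = p * \<kappa>" using p by (simp add: \<kappa>_def)
    then have "\<kappa> * \<bar>\<kappa>\<bar> powr (p - 2) * ((\<beta> + p) * y) = p * (\<bar>\<kappa>\<bar> powr (p - 2) * (\<kappa> * \<kappa>)) * y" for y
      by (simp only: mult_ac)
    then have "(p - 1) * \<bar>\<kappa>\<bar> powr p * y
        = \<kappa> * \<bar>\<kappa>\<bar> powr (p - 2) * ((\<beta> + p) * y) - \<bar>\<kappa>\<bar> powr p * y" for y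
      by (simp only: abs_powr_diff_two_mult_square) (simp add: left_diff_distrib)
    moreover have "C x = cmod (euler_deriv f x) powr p / w (\<beta> + 1) x
        + (p - 1) * \<bar>\<kappa>\<bar> powr p * (F x / w (\<beta> + p + 1) x)
        + \<kappa> * \<bar>\<kappa>\<bar> powr (p - 2) * (T x / w (\<beta> + p) x)"
      unfolding C_def eta_fun_def xi_fun_def radial_deriv_eq[OF df] \<kappa>_def[symmetric] w_def F_def T_def
      by (rule Cp_weighted[OF x(1) logw_pos[OF x] p])
    moreover have "a + (k * z - y) + k * t = a - y + k * (t - h + z + h)" for a k z y t h :: real
      by (simp add: algebra_simps)
    ultimately show ?thesis
      using x by (simp only: G_def D_def) simp
  next
    case False
    then have "C x = 0"
      using f0 e0 by (simp add: C_def xi_fun_def eta_fun_def radial_deriv_eq[OF df] Cp_def)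
    moreover have "G x = 0"
      using False F0 D0 e0 by (simp add: G_def)
    ultimately show ?thesis by simp
  qed
  show "set_integrable lebesgue {x. q x < R} C"
    unfolding set_integrable_def C_eq using iG by (rule integrable_completion[THEN iffD2, rotated]) (use iG in auto)
  \<comment> \<open>The p-th power of the factor 1/|x| in the radial derivative raises the weight
    exponent from \<alpha> to \<alpha> + p.\<close>
  have A: "wint q R \<alpha> (\<beta> + 1) (\<lambda>x. cmod (radial_deriv \<nu> q f x) powr p)
      = (LBINT x. cmod (euler_deriv f x) powr p / w (\<beta> + 1) x)"
  proof -
    have "wint q R \<alpha> (\<beta> + 1) (\<lambda>x. cmod (radial_deriv \<nu> q f x) powr p)
      = (LBINT x. cmod (radial_deriv \<nu> q f x) powr p / (q x powr \<alpha> * logw q R x powr (\<beta> + 1)))"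
    proof (rule wint_eq_lborel[OF K])
      have [measurable]: "euler_deriv f \<in> borel_measurable borel"
        using ce by (rule borel_measurable_continuous_onI)
      show "(\<lambda>x. cmod (radial_deriv \<nu> q f x) powr p) \<in> borel_measurable borel"
        unfolding radial_deriv_eq[OF df] by measurable
      show "cmod (radial_deriv \<nu> q f x) powr p = 0" if "x \<notin> K" for x
        unfolding radial_deriv_eq[OF df] using e0[OF that] by simp
    qed
    also have "\<dots> = (LBINT x. cmod (euler_deriv f x) powr p / w (\<beta> + 1) x)"
    proof (rule Bochner_Integration.integral_cong)
      fix x
      show "cmod (radial_deriv \<nu> q f x) powr p / (q x powr \<alpha> * logw q R x powr (\<beta> + 1))
          = cmod (euler_deriv f x) powr p / w (\<beta> + 1) x"
        unfolding radial_deriv_eq[OF df] w_def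
        using q_nonneg[of x] by (simp add: norm_divide powr_divide powr_add mult_ac)
    qed simp
    finally show ?thesis .
  qed
  have [measurable]: "F \<in> borel_measurable borel"
    using cF by (rule borel_measurable_continuous_onI)
  have B: "wint q R (\<alpha> + p) b F = (LBINT x. F x / w b x)" for b
    unfolding w_def by (rule wint_eq_lborel[OF K _ F0]) auto
  have "(LINT x:{x. q x < R}|lebesgue. C x) = integral\<^sup>L lborel G"
    unfolding set_lebesgue_integral_def C_eq using iG by (intro integral_completion) auto
  also have "\<dots> = (LBINT x. cmod (euler_deriv f x) powr p / w (\<beta> + 1) x) - \<bar>\<kappa>\<bar> powr p * (LBINT x. F x / w (\<beta> + p + 1) x)
    + \<kappa> * \<bar>\<kappa>\<bar> powr (p - 2) * (- hom_dim \<nu> * (LBINT x. F x / w (\<beta> + p) x) + (\<alpha> + p) * (LBINT x. F x / w (\<beta> + p) x))"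
    unfolding G_def
    by (intro has_bochner_integral_integral_eq has_bochner_integral_add has_bochner_integral_diff
        has_bochner_integral_mult_right has_bochner_integral_integrable iE iF
        has_bochner_integral_integrable[OF D_int(1), unfolded D_int(2)])
  finally show "(LINT x:{x. q x < R}|lebesgue. C x)
      = wint q R \<alpha> (\<beta> + 1) (\<lambda>x. cmod (radial_deriv \<nu> q f x) powr p)
        - \<bar>\<kappa>\<bar> powr p * wint q R (\<alpha> + p) (\<beta> + p + 1) (\<lambda>x. cmod (f x) powr p)
        - (hom_dim \<nu> - \<alpha> - p) * \<kappa> * \<bar>\<kappa>\<bar> powr (p - 2) * wint q R (\<alpha> + p) (\<beta> + p) (\<lambda>x. cmod (f x) powr p)"
    using B unfolding F_def[symmetric] A by (simp add: F_def[symmetric] algebra_simps)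
qed

end

section \<open>The inequality and the vanishing of the remainder\<close>

context homogeneous_norm
begin

lemma hardy_inequality:
  assumes R: "0 < R" and p: "1 < p" and f: "test_fun q R f"
    and sgn: "0 \<le> (hom_dim \<nu> - \<alpha> - p) * (\<beta> + p)"
  shows "\<bar>(\<beta> + p) / p\<bar> powr p * wint q R (\<alpha> + p) (\<beta> + p + 1) (\<lambda>x. cmod (f x) powr p)
    \<le> wint q R \<alpha> (\<beta> + 1) (\<lambda>x. cmod (radial_deriv \<nu> q f x) powr p)"
proof -
  have "0 \<le> (LINT x:{x. q x < R}|lebesgue. Cp p (xi_fun \<nu> q R \<alpha> \<beta> p f x) (eta_fun \<nu> q R \<alpha> \<beta> p f x))"
    unfolding set_lebesgue_integral_def using Cp_nonneg[OF p] by (intro integral_nonneg_AE) simp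
  moreover have "0 \<le> wint q R (\<alpha> + p) (\<beta> + p) (\<lambda>x. cmod (f x) powr p)"
    unfolding wint_def set_lebesgue_integral_def by (intro integral_nonneg_AE) simp
  moreover have "0 \<le> (hom_dim \<nu> - \<alpha> - p) * ((\<beta> + p) / p) * \<bar>(\<beta> + p) / p\<bar> powr (p - 2)"
    using sgn p by (simp add: zero_le_mult_iff zero_le_divide_iff)
  moreover note mult_nonneg_nonneg[OF this calculation(2)]
  ultimately show ?thesis
    using remainder_identity(2)[OF R p f, of \<alpha> \<beta>] by linarith
qed

text \<open>On an orbit the equation reads f' = -\<kappa> f / (L - t), with integrating factor (L -
  t)^(-\<kappa>). Hence f is L^\<kappa> times a constant on each orbit, and this constant is 0
  because the orbit leaves the support when followed towards the origin.\<close>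

lemma test_fun_eq_0_if_euler_ode:
  assumes R: "0 < R" and f: "test_fun q R f"
    and ode: "\<And>x. 0 < q x \<Longrightarrow> q x < R \<Longrightarrow> euler_deriv f x = - of_real (\<kappa> / logw q R x) * f x"
  shows "f x = 0"
proof (rule ccontr)
  assume fx: "f x \<noteq> 0"
  obtain K where K: "compact K" "K \<subseteq> {x. 0 < q x \<and> q x < R}" and f0: "\<And>x. x \<notin> K \<Longrightarrow> f x = 0"
    and df: "\<And>x. f differentiable at x"
    using test_fun_support[OF f] by metis
  have xK: "x \<in> K" using fx f0 by blast
  then have x: "0 < q x" "q x < R" using K(2) by auto
  obtain y where y: "y \<in> K" "\<And>z. z \<in> K \<Longrightarrow> q y \<le> q z"
    using continuous_attains_inf[OF K(1), of q] xK continuous_on_subset[OF q_cont] by blast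
  have qy: "0 < q y" "q y \<le> q x" using y xK K(2) by auto
  \<comment> \<open>The time at which the quasi-norm has dropped to half of its minimum
    \<open>q y\<close> over \<open>K\<close>.\<close>
  define s where "s = ln (q y / (2 * q x))"
  have s: "s < 0" using qy x by (simp add: s_def ln_less_zero_iff)
  have "q (dil \<nu> (exp s) x) = q y / 2" using qy x by (simp add: q_dil s_def)
  then have "dil \<nu> (exp s) x \<notin> K" using y(2)[of "dil \<nu> (exp s) x"] qy by auto
  then have end0: "f (dil \<nu> (exp s) x) = 0" by (rule f0)
  define L where "L = logw q R x"
  have L: "0 < L" using x logw_pos by (simp add: L_def)
  define z where "z t = of_real ((L - t) powr (- \<kappa>)) * f (dil \<nu> (exp t) x)" for t
  have "(z has_vector_derivative 0) (at t within {s..0})" if "t \<in> {s..0}" for t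
  proof -
    have t: "t \<le> 0" using that by simp
    have "exp t * q x \<le> q x" using t x by (simp add: mult_left_le_one_le)
    then have in_ball: "0 < q (dil \<nu> (exp t) x)" "q (dil \<nu> (exp t) x) < R"
      using x by (simp_all only: q_dil exp_gt_zero mult_pos_pos)
    have lw: "logw q R (dil \<nu> (exp t) x) = L - t"
      using R x by (simp add: logw_dil L_def)
    have 1: "((\<lambda>t. f (dil \<nu> (exp t) x)) has_vector_derivative
        - of_real (\<kappa> / (L - t)) * f (dil \<nu> (exp t) x)) (at t)"
      using euler_deriv_flow[where t = t and x = x, OF df] ode[OF in_ball] by (simp add: lw)
    have "((\<lambda>t. (L - t) powr (- \<kappa>)) has_real_derivative \<kappa> * (L - t) powr (- \<kappa> - 1)) (at t)"
      using L t by (auto intro!: derivative_eq_intros)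
    then have 2: "((\<lambda>t. of_real ((L - t) powr (- \<kappa>)) :: complex) has_vector_derivative
        of_real (\<kappa> * (L - t) powr (- \<kappa> - 1))) (at t)"
      by (rule has_vector_derivative_of_real)
    have "of_real ((L - t) powr (- \<kappa>)) * (- of_real (\<kappa> / (L - t)) * f (dil \<nu> (exp t) x))
        + of_real (\<kappa> * (L - t) powr (- \<kappa> - 1)) * f (dil \<nu> (exp t) x) = 0"
      using L t by (simp add: powr_diff)
    then show ?thesis
      using has_vector_derivative_mult[OF 2 1] unfolding z_def
      by (simp add: has_vector_derivative_at_within)
  qed
  then obtain c where c: "\<And>t. t \<in> {s..0} \<Longrightarrow> z t = c"
    using has_vector_derivative_zero_constant[of "{s..0}" z] by (metis convex_real_interval(5))
  have "z 0 = 0" using c[of 0] c[of s] end0 s by (simp add: z_def)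
  then show False
    using fx L by (simp add: z_def dil_1)
qed

lemma remainder_zero_imp_zero:
  assumes R: "0 < R" and p: "1 < p" and f: "test_fun q R f"
    and zero: "(LINT x:{x. q x < R}|lebesgue. Cp p (xi_fun \<nu> q R \<alpha> \<beta> p f x) (eta_fun \<nu> q R \<alpha> \<beta> p f x)) = 0"
  shows "f x = 0"
proof -
  obtain K where K: "compact K" "K \<subseteq> {x. 0 < q x \<and> q x < R}" 
    and df: "\<And>x. f differentiable at x"
    and cf: "continuous_on UNIV f" and ce: "continuous_on UNIV (euler_deriv f)"
    using test_fun_support[OF f] by metis
  define C where "C x = Cp p (xi_fun \<nu> q R \<alpha> \<beta> p f x) (eta_fun \<nu> q R \<alpha> \<beta> p f x)" for x
  define U where "U = {x. 0 < q x \<and> q x < R}"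
  have U: "open U"
    unfolding U_def by (intro open_Collect_conj open_Collect_less continuous_intros q_cont)
  \<comment> \<open>The numerator of \<eta> once its positive weight is split off; being continuous
    on the punctured ball, it can be handled by \<open>open_AE_imp_empty\<close>.\<close>
  define g where "g x = euler_deriv f x + of_real ((\<beta> + p) / p / logw q R x) * f x" for x
  have eta: "eta_fun \<nu> q R \<alpha> \<beta> p f x
      = g x / of_real (q x * (q x powr (\<alpha> / p) * logw q R x powr ((\<beta> + 1) / p)))" if "x \<in> U" for x
  proof -
    have q: "0 < q x" and L: "0 < logw q R x" using that logw_pos by (auto simp: U_def)
    have "q x powr ((\<alpha> + p) / p) = q x * q x powr (\<alpha> / p)"
      using q p by (simp add: add_divide_distrib powr_add)
    moreover have "logw q R x powr ((\<beta> + p + 1) / p) = logw q R x * logw q R x powr ((\<beta> + 1) / p)"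
      using L p by (simp add: add_divide_distrib powr_add)
    moreover have "e / a / (b * c) + k * z / (a * b * (l * c)) = (e + k / l * z) / (a * (b * c))"
      for a b c e k l z :: complex
      by (simp add: add_divide_distrib mult_ac)
    ultimately show ?thesis
      by (simp only: eta_fun_def xi_fun_def radial_deriv_eq[OF df] g_def of_real_mult
          of_real_divide[of _ "logw q R x"])
  qed
  have "integrable lebesgue (\<lambda>x. indicator {x. q x < R} x *\<^sub>R C x)"
    using remainder_identity(1)[OF R p f, of \<alpha> \<beta>] unfolding C_def set_integrable_def .
  moreover have "(LINT x|lebesgue. indicator {x. q x < R} x *\<^sub>R C x) = 0"
    using zero unfolding C_def set_lebesgue_integral_def .
  moreover have "0 \<le> indicator {x. q x < R} x *\<^sub>R C x" for x
    using Cp_nonneg[OF p] by (simp add: C_def)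
  ultimately have "AE x in lebesgue. indicator {x. q x < R} x *\<^sub>R C x = 0"
    by (simp add: integral_nonneg_eq_0_iff_AE)
  then have "AE x in lebesgue. x \<notin> {x \<in> U. g x \<noteq> 0}"
  proof (rule AE_mp, intro AE_I2 impI notI)
    fix x assume "indicator {x. q x < R} x *\<^sub>R C x = 0" and x: "x \<in> {x \<in> U. g x \<noteq> 0}"
    then have "C x = 0" by (simp add: U_def)
    then have "eta_fun \<nu> q R \<alpha> \<beta> p f x = 0"
      using Cp_pos[OF p, of "eta_fun \<nu> q R \<alpha> \<beta> p f x" "xi_fun \<nu> q R \<alpha> \<beta> p f x"]
      unfolding C_def by (cases "eta_fun \<nu> q R \<alpha> \<beta> p f x = 0") simp_all
    moreover have "0 < q x" "0 < logw q R x" using x logw_pos by (simp_all add: U_def)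
    ultimately show False using x eta[of x] by simp
  qed
  moreover have "continuous_on U g"
    unfolding g_def using continuous_on_logw[of R] logw_pos
    by (intro continuous_intros continuous_on_subset[OF cf] continuous_on_subset[OF ce])
      (simp_all add: U_def less_imp_neq[symmetric])
  then have "open {x \<in> U. g x \<noteq> 0}"
    using continuous_on_open_vimage[OF U, of g, THEN iffD1, rule_format, of "- {0}"]
    by (simp add: vimage_def Collect_conj_eq Int_commute open_Compl)
  ultimately have "{x \<in> U. g x \<noteq> 0} = {}"
    using open_AE_imp_empty by blast
  then have "euler_deriv f x = - of_real ((\<beta> + p) / p / logw q R x) * f x" if "0 < q x" "q x < R" for x
    using that by (auto simp: U_def g_def eq_neg_iff_add_eq_0)
  from test_fun_eq_0_if_euler_ode[OF R f this] show ?thesis .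
qed

end

section \<open>Smooth test functions\<close>

text \<open>A coinductive notion of smoothness on the line: some class of functions closed under
  differentiation contains the function.\<close>
definition smooth_real :: "(real \<Rightarrow> real) \<Rightarrow> bool" where
  "smooth_real g \<longleftrightarrow> (\<exists>S. g \<in> S \<and> (\<forall>h\<in>S. \<exists>h'\<in>S. \<forall>x. (h has_real_derivative h' x) (at x)))"

lemma smooth_real_coinduct:
  assumes "g \<in> S" "\<And>h. h \<in> S \<Longrightarrow> \<exists>h'\<in>S. \<forall>x. (h has_real_derivative h' x) (at x)"
  shows "smooth_real g"
  using assms unfolding smooth_real_def by blast

lemma smooth_realE:
  assumes "smooth_real g"
  obtains g' where "smooth_real g'" "\<And>x. (g has_real_derivative g' x) (at x)"
proof -
  obtain S where S: "g \<in> S" "\<forall>h\<in>S. \<exists>h'\<in>S. \<forall>x. (h has_real_derivative h' x) (at x)"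
    using assms unfolding smooth_real_def by blast
  then obtain g' where "g' \<in> S" "\<And>x. (g has_real_derivative g' x) (at x)" by blast
  with S(2) that show ?thesis using smooth_real_coinduct by blast
qed

lemma smooth_real_lincomb:
  assumes "smooth_real u" "smooth_real v"
  shows "smooth_real (\<lambda>x. a * u x + b * v x)"
proof (rule smooth_real_coinduct[where S = "{\<lambda>x. a * u x + b * v x |u v. smooth_real u \<and> smooth_real v}"])
  fix h assume "h \<in> {\<lambda>x. a * u x + b * v x |u v. smooth_real u \<and> smooth_real v}"
  then obtain u v where h: "h = (\<lambda>x. a * u x + b * v x)" and "smooth_real u" "smooth_real v" by blast
  then obtain u' v' where u': "smooth_real u'" "\<And>x. (u has_real_derivative u' x) (at x)"
    and v': "smooth_real v'" "\<And>x. (v has_real_derivative v' x) (at x)"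
    by (metis smooth_realE)
  then have "\<forall>x. (h has_real_derivative (a * u' x + b * v' x)) (at x)"
    unfolding h by (auto intro!: DERIV_add DERIV_cmult)
  with u'(1) v'(1) show "\<exists>h'\<in>{\<lambda>x. a * u x + b * v x |u v. smooth_real u \<and> smooth_real v}.
      \<forall>x. (h has_real_derivative h' x) (at x)"
    by (intro bexI[of _ "\<lambda>x. a * u' x + b * v' x"]) auto
qed (use assms in blast)

lemma smooth_real_affine:
  assumes "smooth_real u"
  shows "smooth_real (\<lambda>x. u (a * x + b))"
proof (rule smooth_real_coinduct[where S = "{\<lambda>x. u (a * x + b) |u. smooth_real u}"])
  fix h assume "h \<in> {\<lambda>x. u (a * x + b) |u. smooth_real u}"
  then obtain u where h: "h = (\<lambda>x. u (a * x + b))" and "smooth_real u" by blast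
  then obtain u' where u': "smooth_real u'" "\<And>x. (u has_real_derivative u' x) (at x)"
    by (metis smooth_realE)
  \<comment> \<open>The zero summand gives the derivative the shape of
    \<open>smooth_real_lincomb\<close>.\<close>
  have "(h has_real_derivative (a * u' (a * x + b) + 0 * u' (a * x + b))) (at x)" for x
  proof -
    have "((\<lambda>x. a * x + b) has_real_derivative a) (at x)"
      by (auto intro!: derivative_eq_intros)
    from DERIV_chain2[OF u'(2) this] show ?thesis unfolding h by (simp add: mult.commute)
  qed
  with smooth_real_lincomb[OF u'(1) u'(1), of a 0]
  show "\<exists>h'\<in>{\<lambda>x. u (a * x + b) |u. smooth_real u}. \<forall>x. (h has_real_derivative h' x) (at x)"
    by (intro bexI[of _ "\<lambda>x. a * u' (a * x + b) + 0 * u' (a * x + b)"]) auto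
qed (use assms in blast)

text \<open>The Leibniz rule turns one product into a sum of two, so the class used for coinduction
  has to contain sums as well.\<close>

inductive_set products_span :: "(real \<Rightarrow> real) set" where
  "smooth_real u \<Longrightarrow> smooth_real v \<Longrightarrow> (\<lambda>x. u x * v x) \<in> products_span"
| "g \<in> products_span \<Longrightarrow> h \<in> products_span \<Longrightarrow> (\<lambda>x. g x + h x) \<in> products_span"

lemma smooth_real_mult:
  assumes "smooth_real u" "smooth_real v"
  shows "smooth_real (\<lambda>x. u x * v x)"
proof (rule smooth_real_coinduct[where S = products_span])
  show "\<exists>h'\<in>products_span. \<forall>x. (h has_real_derivative h' x) (at x)" if "h \<in> products_span" for h
    using that
  proof (induction rule: products_span.induct)
    case (1 u v)
    then obtain u' v' where *: "smooth_real u'" "\<And>x. (u has_real_derivative u' x) (at x)"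
      "smooth_real v'" "\<And>x. (v has_real_derivative v' x) (at x)"
      by (metis smooth_realE)
    with 1 have "(\<lambda>x. u' x * v x + v' x * u x) \<in> products_span"
      by (intro products_span.intros)
    moreover have "\<forall>x. ((\<lambda>x. u x * v x) has_real_derivative u' x * v x + v' x * u x) (at x)"
      using * by (auto intro!: DERIV_mult)
    ultimately show ?case by (intro bexI[of _ "\<lambda>x. u' x * v x + v' x * u x"])
  next
    case (2 g h)
    then obtain g' h' where "g' \<in> products_span" "h' \<in> products_span"
      "\<forall>x. (g has_real_derivative g' x) (at x)" "\<forall>x. (h has_real_derivative h' x) (at x)"
      by blast
    then show ?case
      by (intro bexI[of _ "\<lambda>x. g' x + h' x"]) (auto intro: DERIV_add products_span.intros)
  qed
qed (use assms products_span.intros in blast)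

section \<open>Flat functions and bumps\<close>

definition flat :: "real poly \<Rightarrow> real \<Rightarrow> real" where
  "flat P x = (if x > 0 then poly P (1 / x) * exp (- (1 / x)) else 0)"

lemma poly_times_exp_tendsto_0: "((\<lambda>y. poly P y * exp (- y)) \<longlongrightarrow> (0::real)) at_top"
proof -
  have "((\<lambda>y. \<Sum>i\<le>degree P. coeff P i * (y ^ i / exp y)) \<longlongrightarrow> (\<Sum>i\<le>degree P. coeff P i * 0)) at_top"
    by (intro tendsto_sum tendsto_mult tendsto_const tendsto_power_div_exp_0)
  then show ?thesis
    by (simp add: poly_altdef sum_distrib_right exp_minus divide_inverse mult.assoc)
qed

text \<open>Differentiating P(1/x) exp(-1/x) again gives a function of this kind, with P replaced by
  X^2 (P - P'). Hence the range of \<open>flat\<close> is closed under differentiation, and at 0 the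
  exponential beats every polynomial in 1/x.\<close>

lemma flat_has_derivative:
  "(flat P has_real_derivative flat ([:0, 0, 1:] * (P - pderiv P)) x) (at x)"
proof -
  consider "x > 0" | "x < 0" | "x = 0" by linarith
  then show ?thesis
  proof cases
    case 1
    have inv: "((\<lambda>x. 1 / x) has_real_derivative - (1 / x)\<^sup>2) (at x)"
      using 1 by (auto intro!: derivative_eq_intros simp: power2_eq_square)
    have "((\<lambda>x. poly P (1 / x) * exp (- (1 / x))) has_real_derivative
        (poly (pderiv P) (1 / x) * - (1 / x)\<^sup>2) * exp (- (1 / x))
        + exp (- (1 / x)) * - (- (1 / x)\<^sup>2) * poly P (1 / x)) (at x)"
      by (intro DERIV_mult DERIV_chain2[OF poly_DERIV inv] DERIV_fun_exp DERIV_minus inv)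
    then have "((\<lambda>x. poly P (1 / x) * exp (- (1 / x))) has_real_derivative
        flat ([:0, 0, 1:] * (P - pderiv P)) x) (at x)"
      by (rule DERIV_cong) (use 1 in \<open>simp add: flat_def power2_eq_square algebra_simps\<close>)
    then show ?thesis
      by (rule has_field_derivative_transform_within_open[where S = "{0<..}"])
        (use 1 in \<open>auto simp: flat_def\<close>)
  next
    case 2
    have "((\<lambda>_. 0) has_real_derivative flat ([:0, 0, 1:] * (P - pderiv P)) x) (at x)"
      using 2 by (simp add: flat_def)
    then show ?thesis
      by (rule has_field_derivative_transform_within_open[where S = "{..<0}"])
        (use 2 in \<open>auto simp: flat_def\<close>)
  next
    case 3
    have "((\<lambda>h. poly ([:0, 1:] * P) (inverse h) * exp (- inverse h)) \<longlongrightarrow> 0) (at_right (0::real))"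
      by (rule filterlim_compose[OF poly_times_exp_tendsto_0 filterlim_inverse_at_top_right])
    then have "((\<lambda>h. flat P h / h) \<longlongrightarrow> 0) (at_right 0)"
      by (rule Lim_transform_eventually)
        (auto simp: flat_def eventually_at_right_field divide_inverse intro!: exI[of _ 1])
    moreover have "((\<lambda>h. flat P h / h) \<longlongrightarrow> 0) (at_left 0)"
      by (rule Lim_transform_eventually[OF tendsto_const])
        (auto simp: flat_def eventually_at_left_field intro!: exI[of _ "-1"])
    ultimately have "((\<lambda>h. flat P h / h) \<longlongrightarrow> 0) (at 0)"
      by (simp add: filterlim_at_split)
    then show ?thesis using 3 by (simp add: DERIV_def flat_def)
  qed
qed

lemma smooth_real_flat: "smooth_real (flat P)"
  by (rule smooth_real_coinduct[where S = "range flat"]) (use flat_has_derivative in blast)+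

definition bump :: "real \<Rightarrow> real" where
  "bump x = flat 1 x * flat 1 (-1 * x + 1)"

lemma smooth_real_bump: "smooth_real bump"
  unfolding bump_def[abs_def] by (intro smooth_real_mult smooth_real_affine smooth_real_flat)

lemma bump_pos: "0 < x \<Longrightarrow> x < 1 \<Longrightarrow> 0 < bump x"
  by (simp add: bump_def flat_def)

lemma bump_eq_0: "x \<notin> {0<..<1} \<Longrightarrow> bump x = 0"
  by (auto simp: bump_def flat_def)

lemma bump_nonneg: "0 \<le> bump x"
  using bump_pos[of x] bump_eq_0[of x] by force

section \<open>Powers cut off in logarithmic scale\<close>

definition log_power :: "real \<Rightarrow> (real \<Rightarrow> real) \<Rightarrow> real \<Rightarrow> real" where
  "log_power a u s = (if s > 0 then s powr a * u (ln s) else 0)"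

text \<open>The pair (a, u) is sent to (a - 1, a u + u'). As u vanishes left of c, the function is
  zero on the whole half-line below \<open>exp c\<close>, which settles the point 0.\<close>

lemma log_power_has_derivative:
  assumes u: "\<And>x. (u has_real_derivative u' x) (at x)" and u0: "\<And>x. x < c \<Longrightarrow> u x = 0"
  shows "(log_power a u has_real_derivative log_power (a - 1) (\<lambda>x. a * u x + 1 * u' x) s) (at s)"
proof (cases "s > 0")
  case True
  have 1: "((\<lambda>s. u (ln s)) has_real_derivative u' (ln s) * (1 / s)) (at s)"
    by (rule DERIV_chain2[OF u DERIV_ln_divide[OF True]])
  have 2: "((\<lambda>s. s powr a) has_real_derivative a * s powr (a - 1)) (at s)"
    using True by (auto intro!: derivative_eq_intros)
  have "((\<lambda>s. s powr a * u (ln s)) has_real_derivative log_power (a - 1) (\<lambda>x. a * u x + 1 * u' x) s) (at s)"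
    by (rule DERIV_cong[OF DERIV_mult[OF 2 1]])
      (use True in \<open>simp add: log_power_def powr_diff algebra_simps add_divide_distrib\<close>)
  then show ?thesis
    by (rule has_field_derivative_transform_within_open[where S = "{0<..}"])
      (use True in \<open>auto simp: log_power_def\<close>)
next
  case False
  have "((\<lambda>_. 0) has_real_derivative log_power (a - 1) (\<lambda>x. a * u x + 1 * u' x) s) (at s)"
    using False by (simp add: log_power_def)
  note zero = this
  have "0 = log_power a u t" if "t \<in> {..<exp c}" for t
  proof (cases "t > 0")
    case True
    then have "ln t < c" using that ln_ge_iff[of t c] by auto
    then show ?thesis using u0 by (simp add: log_power_def)
  qed (simp add: log_power_def)
  moreover have "s \<in> {..<exp c}" using False exp_gt_zero[of c] unfolding lessThan_iff by linarith
  ultimately show ?thesis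
    using has_field_derivative_transform_within_open[OF zero open_lessThan] by blast
qed

lemma smooth_real_log_power:
  assumes "smooth_real u" "\<And>x. x < c \<Longrightarrow> u x = 0"
  shows "smooth_real (log_power a u)"
proof (rule smooth_real_coinduct[where S = "{log_power a u |a u. smooth_real u \<and> (\<forall>x<c. u x = 0)}"])
  fix h assume "h \<in> {log_power a u |a u. smooth_real u \<and> (\<forall>x<c. u x = 0)}"
  then obtain a u where h: "h = log_power a u" and u: "smooth_real u" "\<And>x. x < c \<Longrightarrow> u x = 0" by blast
  obtain u' where u': "smooth_real u'" "\<And>x. (u has_real_derivative u' x) (at x)"
    using smooth_realE[OF u(1)] by blast
  have "u' x = 0" if "x < c" for x
  proof -
    have "(u has_real_derivative 0) (at x)"
      by (rule has_field_derivative_transform_within_open[OF DERIV_const[of 0], where S = "{..<c}"])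
        (use that u(2) in auto)
    with u'(2) DERIV_unique show ?thesis by blast
  qed
  with u u' have "log_power (a - 1) (\<lambda>x. a * u x + 1 * u' x) \<in> {log_power a u |a u. smooth_real u \<and> (\<forall>x<c. u x = 0)}"
    using smooth_real_lincomb[of u u' a 1] by force
  moreover have "\<forall>x. (h has_real_derivative log_power (a - 1) (\<lambda>x. a * u x + 1 * u' x) x) (at x)"
    unfolding h using log_power_has_derivative[OF u'(2) u(2)] by blast
  ultimately show "\<exists>h'\<in>{log_power a u |a u. smooth_real u \<and> (\<forall>x<c. u x = 0)}. \<forall>x. (h has_real_derivative h' x) (at x)"
    by blast
qed (use assms in blast)

section \<open>Tensor products as smooth functions\<close>

lemma smooth_fun_coinduct:
  assumes "f \<in> S" "\<And>g x. g \<in> S \<Longrightarrow> g differentiable at x" "\<And>g v. g \<in> S \<Longrightarrow> dirderiv g v \<in> S"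
  shows "smooth_fun f"
proof -
  have "iter_dirderiv f vs \<in> S" for vs
    by (induction vs) (use assms in auto)
  then show ?thesis using assms(2) by (simp add: smooth_fun_def)
qed

lemma tensor_has_derivative:
  fixes G :: "'n::finite \<Rightarrow> real \<Rightarrow> real"
  assumes "\<And>i x. (G i has_real_derivative G' i x) (at x)"
  shows "((\<lambda>x::real^'n. complex_of_real (\<Prod>i\<in>UNIV. G i (x $ i))) has_derivative
    (\<lambda>v. \<Sum>i\<in>UNIV. of_real (v $ i) * of_real (\<Prod>j\<in>UNIV. (G(i := G' i)) j (x $ j)))) (at x)"
proof -
  have 1: "((\<lambda>x. G i (x $ i)) has_derivative (\<lambda>v. G' i (x $ i) * v $ i)) (at x)" for i
    using has_derivative_compose[OF bounded_linear_imp_has_derivative[OF bounded_linear_vec_nth]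
        assms[of i "x $ i", unfolded has_field_derivative_def]] by simp
  have "((\<lambda>x. \<Prod>i\<in>UNIV. G i (x $ i)) has_derivative
    (\<lambda>v. \<Sum>i\<in>UNIV. G' i (x $ i) * v $ i * (\<Prod>j\<in>UNIV - {i}. G j (x $ j)))) (at x)"
    by (rule has_derivative_prod) (rule 1)
  then have "((\<lambda>x. complex_of_real (\<Prod>i\<in>UNIV. G i (x $ i))) has_derivative
    (\<lambda>v. complex_of_real (\<Sum>i\<in>UNIV. G' i (x $ i) * v $ i * (\<Prod>j\<in>UNIV - {i}. G j (x $ j))))) (at x)"
    by (rule has_derivative_of_real)
  moreover have "(\<Prod>j\<in>UNIV. (G(i := G' i)) j (x $ j)) = G' i (x $ i) * (\<Prod>j\<in>UNIV - {i}. G j (x $ j))" for i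
    by (subst prod.remove[of _ i]) (auto intro!: prod.cong)
  ultimately show ?thesis
    by (simp add: mult_ac)
qed

text \<open>A directional derivative of a tensor product is a linear combination of tensor products
  with one factor differentiated, so closure under scalars and sums makes this class invariant under
  \<open>dirderiv\<close>.\<close>

inductive_set tensor_span :: "(real^'n::finite \<Rightarrow> complex) set" where
  "(\<And>i. smooth_real (G i)) \<Longrightarrow> (\<lambda>x. of_real (\<Prod>i\<in>UNIV. G i (x $ i))) \<in> tensor_span"
| "f \<in> tensor_span \<Longrightarrow> (\<lambda>x. c * f x) \<in> tensor_span"
| "f \<in> tensor_span \<Longrightarrow> g \<in> tensor_span \<Longrightarrow> (\<lambda>x. f x + g x) \<in> tensor_span"

lemma tensor_span_sum:
  assumes "finite I" "I \<noteq> {}" "\<And>i. i \<in> I \<Longrightarrow> f i \<in> tensor_span"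
  shows "(\<lambda>x. \<Sum>i\<in>I. f i x) \<in> tensor_span"
  using assms by (induction I rule: finite_ne_induct) (auto intro: tensor_span.intros)

lemma tensor_span_derivative:
  assumes "f \<in> tensor_span"
  shows "\<exists>f'. (\<forall>x. (f has_derivative f' x) (at x)) \<and> (\<forall>v. (\<lambda>x. f' x v) \<in> tensor_span)"
  using assms
proof (induction rule: tensor_span.induct)
  case (1 G)
  have "\<forall>i. \<exists>g'. smooth_real g' \<and> (\<forall>x. (G i has_real_derivative g' x) (at x))"
    using 1 by (metis smooth_realE)
  then obtain G' where G': "\<And>i. smooth_real (G' i)" "\<And>i x. (G i has_real_derivative G' i x) (at x)"
    by metis
  have "(\<lambda>x. \<Sum>i\<in>UNIV. of_real (v $ i) * of_real (\<Prod>j\<in>UNIV. (G(i := G' i)) j (x $ j))) \<in> tensor_span" for v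
    by (intro tensor_span_sum tensor_span.intros) (use 1 G'(1) in auto)
  with tensor_has_derivative[of G G', OF G'(2)] show ?case
    by (intro exI[of _ "\<lambda>x v. \<Sum>i\<in>UNIV. of_real (v $ i) * of_real (\<Prod>j\<in>UNIV. (G(i := G' i)) j (x $ j))"]) simp
next
  case (2 f c)
  then obtain f' where "\<forall>x. (f has_derivative f' x) (at x)" "\<forall>v. (\<lambda>x. f' x v) \<in> tensor_span" by blast
  then show ?case
    by (intro exI[of _ "\<lambda>x v. c * f' x v"]) (auto intro: has_derivative_mult_right tensor_span.intros)
next
  case (3 f g)
  then obtain f' g' where "\<forall>x. (f has_derivative f' x) (at x)" "\<forall>v. (\<lambda>x. f' x v) \<in> tensor_span"
    "\<forall>x. (g has_derivative g' x) (at x)" "\<forall>v. (\<lambda>x. g' x v) \<in> tensor_span" by blast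
  then show ?case
    by (intro exI[of _ "\<lambda>x v. f' x v + g' x v"]) (auto intro: has_derivative_add tensor_span.intros)
qed

lemma smooth_fun_tensor:
  assumes "\<And>i. smooth_real (G i)"
  shows "smooth_fun (\<lambda>x::real^'n::finite. complex_of_real (\<Prod>i\<in>UNIV. G i (x $ i)))"
proof (rule smooth_fun_coinduct[where S = tensor_span])
  fix g :: "real^'n \<Rightarrow> complex" assume "g \<in> tensor_span"
  then obtain g' where g': "\<And>x. (g has_derivative g' x) (at x)" "\<And>v. (\<lambda>x. g' x v) \<in> tensor_span"
    using tensor_span_derivative by blast
  show "g differentiable at x" for x
    using g'(1) differentiable_def by blast
  have "dirderiv g v = (\<lambda>x. g' x v)" for v
    using frechet_derivative_at[OF g'(1)] by (simp add: dirderiv_def fun_eq_iff)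
  then show "dirderiv g v \<in> tensor_span" for v using g'(2) by simp
qed (intro tensor_span.intros assms)

section \<open>The extremal profile on the half-line\<close>

text \<open>The substitution s = exp(N x) turns ds/s into N dx; the support condition confines it to
  the compact interval from 1 to exp N.\<close>

lemma integral_log_substitution:
  fixes \<Phi> :: "real \<Rightarrow> real"
  assumes \<Phi>: "continuous_on UNIV \<Phi>" "\<And>x. x \<notin> {0..1} \<Longrightarrow> \<Phi> x = 0" and N: "0 < N"
  shows "(LBINT s. if s > 0 then \<Phi> (ln s / N) / s else 0) = N * (LBINT x. \<Phi> x)"
proof -
  define f where "f s = \<Phi> (ln s / N) / s" for s
  have cont: "continuous_on {1..exp N} f"
    unfolding f_def using N
    by (intro continuous_intros continuous_on_compose2[OF \<Phi>(1)]) auto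
  have int: "set_integrable lborel {exp (N * 0)..exp (N * 1)} f"
    unfolding set_integrable_def using borel_integrable_compact[OF compact_Icc cont] by simp
  have "(LBINT s. f s * indicator {exp (N * 0)..exp (N * 1)} s)
      = (LBINT x. f (exp (N * x)) * (N * exp (N * x)) * indicator {0..1} x)"
    using N by (intro integral_substitution(2)[where g = "\<lambda>x. exp (N * x)"] int)
      (auto intro!: derivative_eq_intros continuous_intros)
  moreover have "f s * indicator {exp (N * 0)..exp (N * 1)} s = (if s > 0 then \<Phi> (ln s / N) / s else 0)" for s
  proof (cases "s \<in> {1..exp N}")
    case False
    have "ln s / N \<notin> {0..1}" if "s > 0"
      using that False N ln_ge_iff[of s 0] ln_le_cancel_iff[of s "exp N"]
      by (auto simp: divide_simps)
    then show ?thesis using False \<Phi>(2) by auto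
  qed (use N in \<open>auto simp: f_def\<close>)
  moreover have "f (exp (N * x)) * (N * exp (N * x)) * indicator {0..1} x = N * \<Phi> x" for x
    using N \<Phi>(2)[of x] by (cases "x \<in> {0..1}") (auto simp: f_def)
  ultimately show ?thesis by simp
qed

lemma compact_support_deriv_0:
  fixes u :: "real \<Rightarrow> real"
  assumes "\<And>x. (u has_real_derivative u' x) (at x)" "\<And>x. x \<notin> {a..b} \<Longrightarrow> u x = 0" "x \<notin> {a..b}"
  shows "u' x = 0"
proof -
  have "(u has_real_derivative 0) (at x)"
    by (rule has_field_derivative_transform_within_open[OF DERIV_const[of 0], where S = "- {a..b}"])
      (use assms(2,3) in auto)
  with assms(1) DERIV_unique show ?thesis by blast
qed

lemma smooth_real_continuous: "smooth_real u \<Longrightarrow> continuous_on S u"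
  by (metis smooth_realE DERIV_continuous_on has_field_derivative_at_within)

lemma continuous_on_bump_powr: "0 < p \<Longrightarrow> continuous_on S (\<lambda>x. bump x powr p)"
  using bump_nonneg
  by (intro continuous_on_powr' continuous_intros smooth_real_continuous smooth_real_bump) auto

lemma bump_powr_integral:
  assumes p: "0 < p"
  shows "integrable lborel (\<lambda>x. bump x powr p)" "0 < (LBINT x. bump x powr p)"
proof -
  show iB: "integrable lborel (\<lambda>x. bump x powr p)"
    by (rule integrable_lborel_compact_support[OF compact_Icc[of 0 1] continuous_on_bump_powr[OF p]])
      (subst bump_eq_0, auto)
  have "(LBINT x. bump x powr p) \<noteq> 0"
  proof
    assume "(LBINT x. bump x powr p) = 0"
    then have "AE x in lborel. bump x powr p = 0"
      using iB by (subst (asm) integral_nonneg_eq_0_iff_AE) auto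
    then have "AE x in lborel. x \<notin> {0<..<1::real}"
      by (rule AE_mp) (intro AE_I2 impI notI, use bump_pos in force)
    then have "AE x in lebesgue. x \<notin> {0<..<1::real}" by (rule AE_completion)
    from open_AE_imp_empty[OF open_greaterThanLessThan this] show False by simp
  qed
  then show "0 < (LBINT x. bump x powr p)"
    by (simp add: less_le)
qed

text \<open>The power s^\<kappa> would be extremal but makes both integrals diverge, so it is cut
  off by a bump in ln s / N. The choice of \<kappa> leaves exactly ds/s in both integrals. After the
  logarithmic substitution both carry a factor N, and their ratio is that of the integrals of
  |\<kappa> bump + bump'/N|^p and bump^p, which tends to |\<kappa>|^p.\<close>

lemma hardy_profile:
  fixes p \<kappa> \<beta> C :: real
  assumes p: "1 < p" and \<kappa>: "\<beta> + p = \<kappa> * p" and C: "\<bar>\<kappa>\<bar> powr p < C"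
  obtains g g' a b where "0 < a" "a \<le> b" "smooth_real g" "\<And>s. (g has_real_derivative g' s) (at s)"
    "continuous_on UNIV g'" "\<And>s. s \<notin> {a..b} \<Longrightarrow> g s = 0" "\<And>s. s \<notin> {a..b} \<Longrightarrow> g' s = 0"
    "(LBINT s. \<bar>g' s\<bar> powr p * s powr (- \<beta> - 1)) < C * (LBINT s. \<bar>g s\<bar> powr p * s powr (- \<beta> - p - 1))"
proof -
  obtain bump' where bump': "smooth_real bump'" "\<And>x. (bump has_real_derivative bump' x) (at x)"
    using smooth_realE[OF smooth_real_bump] by blast
  have b0: "bump x = 0" if "x \<notin> {0..1}" for x using that by (intro bump_eq_0) auto
  have b'0: "bump' x = 0" if "x \<notin> {0..1}" for x
    using compact_support_deriv_0[OF bump'(2) b0 that] .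
  note cb = smooth_real_continuous[OF smooth_real_bump] and cb' = smooth_real_continuous[OF bump'(1)]
  define \<Phi> where "\<Phi> N x = \<bar>\<kappa> * bump x + bump' x / N\<bar> powr p" for N x
  have c\<Phi>: "continuous_on S (\<Phi> N)" for N S
    unfolding \<Phi>_def divide_inverse using p by (intro continuous_on_powr' continuous_intros cb cb') auto
  have \<Phi>0: "\<Phi> N x = 0" if "x \<notin> {0..1}" for N x
    using b0[OF that] b'0[OF that] by (simp add: \<Phi>_def)
  define B where "B = (LBINT x. bump x powr p)"
  note cB = continuous_on_bump_powr[OF less_trans[OF zero_less_one p]]
    and iB = bump_powr_integral(1)[OF less_trans[OF zero_less_one p]]
  have B: "0 < B" unfolding B_def using bump_powr_integral(2) p by simp
  \<comment> \<open>As N is at least 1, the cut-off error bump'/N is dominated by |bump'|, and it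
    disappears in the limit.\<close>
  have "(\<lambda>n. LBINT x. \<Phi> (real (Suc n)) x) \<longlonglongrightarrow> (LBINT x. \<bar>\<kappa>\<bar> powr p * bump x powr p)"
  proof (rule integral_dominated_convergence[where w = "\<lambda>x. (\<bar>\<kappa>\<bar> * bump x + \<bar>bump' x\<bar>) powr p"])
    show "integrable lborel (\<lambda>x. (\<bar>\<kappa>\<bar> * bump x + \<bar>bump' x\<bar>) powr p)"
    proof (rule integrable_lborel_compact_support[OF compact_Icc[of 0 1]])
      show "continuous_on {0..1} (\<lambda>x. (\<bar>\<kappa>\<bar> * bump x + \<bar>bump' x\<bar>) powr p)"
        using p bump_nonneg by (intro continuous_on_powr' continuous_intros cb cb') auto
    qed (use b0 b'0 in auto)
    show "AE x in lborel. (\<lambda>n. \<Phi> (real (Suc n)) x) \<longlonglongrightarrow> \<bar>\<kappa>\<bar> powr p * bump x powr p"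
    proof (rule AE_I2)
      fix x
      have "(\<lambda>n. bump' x * inverse (real (Suc n))) \<longlonglongrightarrow> bump' x * 0"
        by (intro tendsto_mult tendsto_const LIMSEQ_inverse_real_of_nat)
      then have "(\<lambda>n. \<bar>\<kappa> * bump x + bump' x / real (Suc n)\<bar>) \<longlonglongrightarrow> \<bar>\<kappa> * bump x + 0\<bar>"
        by (intro tendsto_rabs tendsto_add tendsto_const) (simp add: divide_inverse)
      from tendsto_powr'[OF this tendsto_const[of p]]
      show "(\<lambda>n. \<Phi> (real (Suc n)) x) \<longlonglongrightarrow> \<bar>\<kappa>\<bar> powr p * bump x powr p"
        using p bump_nonneg[of x] by (simp add: \<Phi>_def abs_mult powr_mult)
    qed
    show "AE x in lborel. norm (\<Phi> (real (Suc n)) x) \<le> (\<bar>\<kappa>\<bar> * bump x + \<bar>bump' x\<bar>) powr p" for n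
    proof (rule AE_I2)
      fix x
      have "\<bar>bump' x / real (Suc n)\<bar> \<le> \<bar>bump' x\<bar>"
        by (simp add: abs_divide divide_le_eq mult_le_cancel_left1)
      then have "\<bar>\<kappa> * bump x + bump' x / real (Suc n)\<bar> \<le> \<bar>\<kappa>\<bar> * bump x + \<bar>bump' x\<bar>"
        using abs_triangle_ineq[of "\<kappa> * bump x" "bump' x / real (Suc n)"] bump_nonneg[of x]
        by (simp add: abs_mult)
      then show "norm (\<Phi> (real (Suc n)) x) \<le> (\<bar>\<kappa>\<bar> * bump x + \<bar>bump' x\<bar>) powr p"
        unfolding \<Phi>_def using p by (simp add: powr_mono2)
    qed
    show "\<Phi> (real (Suc n)) \<in> borel_measurable lborel" for n
      using borel_measurable_continuous_onI[OF c\<Phi>] by simp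
    show "(\<lambda>x. \<bar>\<kappa>\<bar> powr p * bump x powr p) \<in> borel_measurable lborel"
      using iB by simp
  qed
  moreover have "(LBINT x. \<bar>\<kappa>\<bar> powr p * bump x powr p) < C * B"
    using B C by (simp add: B_def)
  ultimately have "eventually (\<lambda>n. (LBINT x. \<Phi> (real (Suc n)) x) < C * B) sequentially"
    by (rule order_tendstoD)
  then obtain n where n: "(LBINT x. \<Phi> (real (Suc n)) x) < C * B"
    by (auto simp: eventually_sequentially)
  define N where "N = real (Suc n)"
  have N: "0 < N" by (simp add: N_def)
  define u where "u x = bump (1 / N * x + 0)" for x
  define u' where "u' x = bump' (x / N) / N" for x
  define g where "g = log_power \<kappa> u"
  define g' where "g' = log_power (\<kappa> - 1) (\<lambda>x. \<kappa> * u x + 1 * u' x)"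
  have u: "smooth_real u"
    unfolding u_def[abs_def] by (rule smooth_real_affine[OF smooth_real_bump])
  have u_deriv: "(u has_real_derivative u' x) (at x)" for x
  proof -
    have "((\<lambda>x. 1 / N * x + 0) has_real_derivative 1 / N) (at x)"
      using N by (auto intro!: derivative_eq_intros)
    from DERIV_chain2[OF bump'(2) this] show ?thesis by (simp add: u_def[abs_def] u'_def)
  qed
  have u0: "u x = 0" if "x < 0" for x
    unfolding u_def using that N by (intro b0) (simp add: zero_le_divide_iff)
  have g: "smooth_real g" unfolding g_def by (rule smooth_real_log_power[OF u u0])
  have g_deriv: "(g has_real_derivative g' s) (at s)" for s
    unfolding g_def g'_def by (rule log_power_has_derivative[OF u_deriv u0])
  have g0: "g s = 0" if "s \<notin> {1..exp N}" for s
  proof (cases "s > 0")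
    case True
    have "ln s / N \<notin> {0..1}"
      using True that N ln_ge_iff[of s 0] ln_le_cancel_iff[of s "exp N"]
      by (auto simp: divide_simps)
    then show ?thesis using b0[of "ln s / N"] by (simp add: g_def log_power_def u_def)
  qed (simp add: g_def log_power_def)
  have g'0: "g' s = 0" if "s \<notin> {1..exp N}" for s
    by (rule compact_support_deriv_0[OF g_deriv g0 that])
  have cg': "continuous_on UNIV g'"
  proof -
    obtain h where h: "smooth_real h" "\<And>s. (g has_real_derivative h s) (at s)"
      using smooth_realE[OF g] by blast
    have "g' = h" using g_deriv h(2) DERIV_unique by blast
    then show ?thesis using smooth_real_continuous[OF h(1)] by simp
  qed
  have "\<bar>g' s\<bar> powr p * s powr (- \<beta> - 1) = (if s > 0 then \<Phi> N (ln s / N) / s else 0)" for s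
  proof (cases "s > 0")
    case True
    have "(\<kappa> - 1) * p + (- \<beta> - 1) = - 1" using \<kappa> by (simp add: algebra_simps)
    then have "s powr ((\<kappa> - 1) * p) * s powr (- \<beta> - 1) = 1 / s"
      using True by (simp only: powr_add[symmetric]) (simp add: powr_minus_divide)
    moreover have "\<bar>g' s\<bar> powr p = \<Phi> N (ln s / N) * s powr ((\<kappa> - 1) * p)"
      using True by (simp add: g'_def log_power_def \<Phi>_def u_def u'_def abs_mult powr_mult powr_powr)
    ultimately show ?thesis using True by (simp only: mult.assoc) simp
  qed (simp add: g'_def log_power_def)
  then have 1: "(LBINT s. \<bar>g' s\<bar> powr p * s powr (- \<beta> - 1)) = N * (LBINT x. \<Phi> N x)"
    using integral_log_substitution[OF c\<Phi> \<Phi>0 N, of N] by simp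
  have "\<bar>g s\<bar> powr p * s powr (- \<beta> - p - 1) = (if s > 0 then bump (ln s / N) powr p / s else 0)" for s
  proof (cases "s > 0")
    case True
    have "\<kappa> * p + (- \<beta> - p - 1) = - 1" using \<kappa> by (simp add: algebra_simps)
    then have "s powr (\<kappa> * p) * s powr (- \<beta> - p - 1) = 1 / s"
      using True by (simp only: powr_add[symmetric]) (simp add: powr_minus_divide)
    moreover have "\<bar>g s\<bar> powr p = bump (ln s / N) powr p * s powr (\<kappa> * p)"
      using True bump_nonneg by (simp add: g_def log_power_def u_def abs_mult powr_mult powr_powr)
    ultimately show ?thesis using True by (simp only: mult.assoc) simp
  qed (simp add: g_def log_power_def)
  then have 2: "(LBINT s. \<bar>g s\<bar> powr p * s powr (- \<beta> - p - 1)) = N * B"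
    unfolding B_def using integral_log_substitution[OF cB _ N] b0 by simp
  show ?thesis
  proof (rule that[of 1 "exp N" g g'])
    show "(LBINT s. \<bar>g' s\<bar> powr p * s powr (- \<beta> - 1)) < C * (LBINT s. \<bar>g s\<bar> powr p * s powr (- \<beta> - p - 1))"
      unfolding 1 2 using n[folded N_def] N by (simp add: mult.left_commute)
  qed (use N g g_deriv cg' g0 g'0 in auto)
qed

section \<open>Sharpness\<close>

lemma lborel_integral_tensor:
  fixes k :: "'n::finite \<Rightarrow> real \<Rightarrow> real"
  assumes k: "\<And>i. integrable lborel (k i)" "\<And>i s. 0 \<le> k i s"
  shows "(LBINT x::real^'n. \<Prod>i\<in>UNIV. k i (x $ i)) = (\<Prod>i\<in>UNIV. LBINT s. k i s)"
proof -
  have [measurable]: "k i \<in> borel_measurable borel" for i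
    using borel_measurable_integrable[OF k(1)] by simp
  have [measurable]: "(\<lambda>x::real^'n. x $ i) \<in> borel_measurable borel" for i
    by (intro borel_measurable_continuous_onI continuous_intros)
  define K where "K b = k (SOME i. b = axis i 1)" for b :: "real^'n"
  have K: "K (axis i 1) = k i" for i
  proof -
    have "(SOME j. axis i (1::real) = axis j 1) = i"
      by (rule some_equality) (auto simp: axis_eq_axis)
    then show ?thesis by (simp add: K_def)
  qed
  have basis: "(Basis :: (real^'n) set) = range (\<lambda>i. axis i 1)"
    by (auto simp: Basis_vec_def)
  have inj: "inj (\<lambda>i::'n. axis i (1::real))"
    by (auto simp: inj_on_def axis_eq_axis)
  have "(\<integral>\<^sup>+(x::real^'n). (\<Prod>b\<in>Basis. ennreal (K b (x \<bullet> b))) \<partial>lborel)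
      = (\<Prod>b\<in>Basis. (\<integral>\<^sup>+s. ennreal (K b s) \<partial>lborel))"
    by (rule nn_integral_lborel_prod) (auto simp: basis K)
  then have "(\<integral>\<^sup>+(x::real^'n). ennreal (\<Prod>i\<in>UNIV. k i (x $ i)) \<partial>lborel) = (\<Prod>i\<in>UNIV. (\<integral>\<^sup>+s. ennreal (k i s) \<partial>lborel))"
    unfolding basis prod.reindex[OF inj] by (simp add: K inner_axis prod_ennreal k(2))
  also have "\<dots> = ennreal (\<Prod>i\<in>UNIV. LBINT s. k i s)"
    using k by (simp add: nn_integral_eq_integral prod_ennreal)
  finally have "(\<integral>\<^sup>+(x::real^'n). ennreal (\<Prod>i\<in>UNIV. k i (x $ i)) \<partial>lborel) = ennreal (\<Prod>i\<in>UNIV. LBINT s. k i s)" .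
  moreover have "0 \<le> (\<Prod>i\<in>UNIV. LBINT s. k i s)"
    by (intro prod_nonneg integral_nonneg_AE) (simp add: k(2))
  ultimately show ?thesis
    using k(2) by (subst integral_eq_nn_integral) (auto intro!: prod_nonneg)
qed

text \<open>The weight exponents may have either sign; a power is monotone one way or the other, so
  an endpoint gives the lower bound.\<close>

lemma powr_ge_min_endpoints:
  fixes x l u A :: real
  assumes "0 < l" "l \<le> x" "x \<le> u"
  shows "min (l powr A) (u powr A) \<le> x powr A"
proof (cases "0 \<le> A")
  case True
  then have "l powr A \<le> x powr A" using assms by (intro powr_mono2) auto
  then show ?thesis by simp
next
  case False
  then have "u powr A \<le> x powr A" using assms by (intro powr_mono2') auto
  then show ?thesis by simp
qed

text \<open>On \<open>K\<close> both weight variables stay in fixed compact intervals of positive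
  numbers, so the denominator is bounded below by a positive constant and the majorant of the
  numerators suffices.\<close>

lemma weighted_dominated_convergence:
  fixes h :: "nat \<Rightarrow> 'a::euclidean_space \<Rightarrow> real"
  assumes meas: "\<And>m. h m \<in> borel_measurable borel" "\<And>m. Q m \<in> borel_measurable borel"
      "\<And>m. L m \<in> borel_measurable borel"
    and K: "compact K" "continuous_on K H"
    and off: "\<And>m y. y \<notin> K \<Longrightarrow> h m y = 0" "\<And>y. y \<notin> K \<Longrightarrow> h' y = 0"
    and dom: "\<And>m y. y \<in> K \<Longrightarrow> \<bar>h m y\<bar> \<le> H y"
    and Q: "0 < q0" "\<And>m y. y \<in> K \<Longrightarrow> q0 \<le> Q m y \<and> Q m y \<le> q1" "\<And>y. y \<in> K \<Longrightarrow> (\<lambda>m. Q m y) \<longlonglongrightarrow> Q' y"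
    and L: "0 < l0" "\<And>m y. y \<in> K \<Longrightarrow> l0 \<le> L m y \<and> L m y \<le> l1" "\<And>y. y \<in> K \<Longrightarrow> (\<lambda>m. L m y) \<longlonglongrightarrow> L' y"
    and lim: "\<And>y. y \<in> K \<Longrightarrow> (\<lambda>m. h m y) \<longlonglongrightarrow> h' y"
  shows "(\<lambda>m. LBINT y. h m y / (Q m y powr A * L m y powr B))
    \<longlonglongrightarrow> (LBINT y. h' y / (Q' y powr A * L' y powr B))"
proof -
  define w where "w = min (q0 powr A) (q1 powr A) * min (l0 powr B) (l1 powr B)"
  define W where "W y = indicator K y *\<^sub>R (H y / w)" for y
  have "continuous_on K (\<lambda>y. H y * inverse w)"
    by (intro continuous_on_mult K continuous_on_const)
  then have W: "integrable lborel W"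
    unfolding W_def divide_inverse by (rule borel_integrable_compact[OF K(1)])
  have m: "(\<lambda>y. h m y / (Q m y powr A * L m y powr B)) \<in> borel_measurable lborel" for m
    using meas(1)[of m] meas(2)[of m] meas(3)[of m] by simp
  have conv: "(\<lambda>m. h m y / (Q m y powr A * L m y powr B)) \<longlonglongrightarrow> h' y / (Q' y powr A * L' y powr B)" for y
  proof (cases "y \<in> K")
    case True
    have "q0 \<le> Q' y" using Q(2,3)[OF True] by (intro LIMSEQ_le_const) auto
    moreover have "l0 \<le> L' y" using L(2,3)[OF True] by (intro LIMSEQ_le_const) auto
    ultimately show ?thesis
      using Q(1,3) L(1,3) lim True by (intro tendsto_intros) auto
  qed (simp add: off)
  have bound: "\<bar>h m y / (Q m y powr A * L m y powr B)\<bar> \<le> W y" for m y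
  proof (cases "y \<in> K")
    case True
    have q: "q0 \<le> Q m y" "Q m y \<le> q1" and l: "l0 \<le> L m y" "L m y \<le> l1" using Q(2) L(2) True by auto
    have pos: "0 < min (q0 powr A) (q1 powr A)" "0 < min (l0 powr B) (l1 powr B)"
      using Q(1) L(1) q l by auto
    then have w: "0 < w" "w \<le> Q m y powr A * L m y powr B"
      unfolding w_def using powr_ge_min_endpoints[OF Q(1) q] powr_ge_min_endpoints[OF L(1) l]
      by (auto intro!: mult_mono simp del: min_less_iff_conj)
    have "\<bar>h m y / (Q m y powr A * L m y powr B)\<bar> = \<bar>h m y\<bar> / (Q m y powr A * L m y powr B)"
      by (simp add: abs_divide abs_mult)
    also have "\<dots> \<le> H y / w"
      using dom[OF True, of m] w by (intro frac_le) auto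
    finally show ?thesis using True by (simp add: W_def)
  qed (simp add: off W_def)
  have m': "(\<lambda>y. h' y / (Q' y powr A * L' y powr B)) \<in> borel_measurable lborel"
    by (rule borel_measurable_LIMSEQ_real[OF conv m])
  show ?thesis
    by (rule integral_dominated_convergence[OF m' m W]) (use conv bound in auto)
qed

text \<open>Coordinates near the axis point with coordinate \<open>c\<close>, which will lie on the
  sphere: \<open>y $ k\<close> is the inward distance along the axis in units of c/m, and the
  transversal coordinates are measured in units of \<delta>. \<open>tube_fun\<close> below is the
  tensor product written in these coordinates.\<close>

definition tube_map :: "'n::finite \<Rightarrow> real \<Rightarrow> real \<Rightarrow> real \<Rightarrow> real^'n \<Rightarrow> real^'n" where
  "tube_map k c m \<delta> y = (\<chi> i. (if i = k then c else 0) + (if i = k then - c / m else \<delta>) * y $ i)"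

definition tube_fun :: "'n::finite \<Rightarrow> real \<Rightarrow> real \<Rightarrow> real \<Rightarrow> ('n \<Rightarrow> real \<Rightarrow> real) \<Rightarrow> real^'n \<Rightarrow> complex" where
  "tube_fun k c m \<delta> G x = complex_of_real
     (\<Prod>i\<in>UNIV. G i ((if i = k then - m / c else 1 / \<delta>) * x $ i + (if i = k then m else 0)))"

text \<open>The i-th partial derivative of the tensor product when \<open>G'\<close> consists of the
  derivatives of \<open>G\<close>.\<close>

definition partial_tensor :: "('n::finite \<Rightarrow> real \<Rightarrow> real) \<Rightarrow> ('n \<Rightarrow> real \<Rightarrow> real) \<Rightarrow> 'n \<Rightarrow> real^'n \<Rightarrow> real" where
  "partial_tensor G G' i y = (\<Prod>j\<in>UNIV. (G(i := G' i)) j (y $ j))"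

lemma tube_fun_tube_map:
  assumes "0 < c" "0 < m" "0 < \<delta>"
  shows "tube_fun k c m \<delta> G (tube_map k c m \<delta> y) = of_real (\<Prod>i\<in>UNIV. G i (y $ i))"
proof -
  have "(if i = k then - m / c else 1 / \<delta>) * tube_map k c m \<delta> y $ i + (if i = k then m else 0) = y $ i" for i
    using assms by (auto simp: tube_map_def field_simps)
  then show ?thesis by (simp only: tube_fun_def)
qed

lemma tube_map_surj:
  assumes "0 < c" "0 < m" "0 < \<delta>"
  shows "tube_map k c m \<delta> (\<chi> i. (if i = k then - m / c else 1 / \<delta>) * x $ i + (if i = k then m else 0)) = x"
  using assms by (auto simp: tube_map_def vec_eq_iff field_simps)

lemma continuous_on_tube_map:
  "continuous_on S (\<lambda>z. tube_map k c m (fst z) (snd z))"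
  unfolding tube_map_def
proof (rule continuous_on_vec_lambda)
  show "continuous_on S (\<lambda>z. (if i = k then c else 0) + (if i = k then - c / m else fst z) * snd z $ i)" for i
    by (intro continuous_on_add continuous_on_mult continuous_on_const continuous_on_component
        continuous_on_snd continuous_on_id) (cases "i = k"; simp add: continuous_on_fst)
qed

lemma smooth_fun_tube_fun:
  assumes "\<And>i. smooth_real (G i)"
  shows "smooth_fun (tube_fun k c m \<delta> G)"
  unfolding tube_fun_def[abs_def] by (intro smooth_fun_tensor smooth_real_affine assms)

text \<open>Each x_i d/dx_i is invariant under scaling, so \<delta> drops out. Along the axis the
  shift by \<open>c\<close> survives as the coefficient \<open>y $ k - m\<close>, the only one that
  grows with m.\<close>

lemma (in homogeneous_norm) euler_deriv_tube_fun:
  assumes G': "\<And>i x. (G i has_real_derivative G' i x) (at x)" and pos: "0 < c" "0 < m" "0 < \<delta>"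
  shows "euler_deriv (tube_fun k c m \<delta> G) (tube_map k c m \<delta> y)
    = of_real (\<Sum>i\<in>UNIV. \<nu> i * (if i = k then y $ i - m else y $ i) * partial_tensor G G' i y)"
proof -
  define A where "A i = (if i = k then - m / c else 1 / \<delta>)" for i
  define B where "B i = (if i = k then m else 0)" for i
  define H where "H i s = G i (A i * s + B i)" for i s
  define H' where "H' i s = A i * G' i (A i * s + B i)" for i s
  define x where "x = tube_map k c m \<delta> y"
  have Ax: "A i * x $ i + B i = y $ i" for i
    using pos by (auto simp: A_def B_def x_def tube_map_def field_simps)
  have "(H i has_real_derivative H' i s) (at s)" for i s
  proof -
    have "((\<lambda>s. A i * s + B i) has_real_derivative A i) (at s)"
      by (auto intro!: derivative_eq_intros)
    from DERIV_chain2[OF G' this] show ?thesis by (simp add: H_def[abs_def] H'_def mult.commute)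
  qed
  from tensor_has_derivative[of H H', OF this]
  have "(tube_fun k c m \<delta> G has_derivative
      (\<lambda>v. \<Sum>i\<in>UNIV. of_real (v $ i) * of_real (\<Prod>j\<in>UNIV. (H(i := H' i)) j (x $ j)))) (at x)"
    by (simp add: tube_fun_def[abs_def] H_def A_def B_def)
  from frechet_derivative_at[OF this, symmetric]
  have "euler_deriv (tube_fun k c m \<delta> G) x
      = of_real (\<Sum>i\<in>UNIV. \<nu> i * x $ i * (\<Prod>j\<in>UNIV. (H(i := H' i)) j (x $ j)))"
    by (simp add: euler_deriv_def euler_field_def)
  moreover have "(\<Prod>j\<in>UNIV. (H(i := H' i)) j (x $ j)) = A i * partial_tensor G G' i y" for i
  proof -
    have "(H(i := H' i)) j (x $ j) = (if j = i then A i else 1) * (G(i := G' i)) j (y $ j)" for j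
      using Ax by (simp add: H_def H'_def)
    then show ?thesis by (simp add: partial_tensor_def prod.distrib)
  qed
  moreover have "A i * x $ i = (if i = k then y $ i - m else y $ i)" for i
    using Ax[of i] by (auto simp: B_def)
  moreover have "a * b * (d * e) = a * (d * b) * e" for a b d e :: real
    by simp
  ultimately show ?thesis
    unfolding x_def[symmetric] by (simp only:)
qed

text \<open>\<open>J\<close> is the Jacobian of the tube coordinates. It is common to both
  integrals, so a strict inequality may be checked in the y variables.\<close>

lemma (in homogeneous_norm) tube_fun_integrals:
  fixes k :: 'n and G G' :: "'n \<Rightarrow> real \<Rightarrow> real"
  assumes R: "0 < R" and p: "1 < p" and pos: "0 < c" "0 < m" "0 < \<delta>"
    and G: "\<And>i. smooth_real (G i)" "\<And>i x. (G i has_real_derivative G' i x) (at x)"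
    and K: "compact K" "\<And>y. y \<notin> K \<Longrightarrow> (\<Prod>i\<in>UNIV. G i (y $ i)) = 0"
    and U: "\<And>y. y \<in> K \<Longrightarrow> 0 < q (tube_map k c m \<delta> y) \<and> q (tube_map k c m \<delta> y) < R"
  defines "\<psi> \<equiv> tube_map k c m \<delta>" and "f \<equiv> tube_fun k c m \<delta> G"
  obtains J where "0 < J" "test_fun q R f"
    "\<And>a b. wint q R a b (\<lambda>x. cmod (f x) powr p)
      = J * (LBINT y. \<bar>\<Prod>i\<in>UNIV. G i (y $ i)\<bar> powr p / (q (\<psi> y) powr a * logw q R (\<psi> y) powr b))"
    "\<And>\<alpha> b. wint q R \<alpha> b (\<lambda>x. cmod (radial_deriv \<nu> q f x) powr p)
      = J * (LBINT y. \<bar>\<Sum>i\<in>UNIV. \<nu> i * (if i = k then y $ i - m else y $ i) * partial_tensor G G' i y\<bar> powr p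
          / (q (\<psi> y) powr (\<alpha> + p) * logw q R (\<psi> y) powr b))"
proof -
  define J where "J = (\<Prod>i\<in>UNIV. \<bar>if i = k then - c / m else \<delta>\<bar>)"
  have J: "0 < J" using pos by (auto simp: J_def intro!: prod_pos)
  have "continuous_on S (\<lambda>y. (\<delta>, y))" for S :: "(real^'n) set"
    by (intro continuous_on_Pair continuous_on_const continuous_on_id)
  from continuous_on_compose2[OF continuous_on_tube_map[of UNIV] this]
  have c\<psi>: "continuous_on S \<psi>" for S by (simp add: \<psi>_def)
  have f0: "f x = 0" if "x \<notin> \<psi> ` K" for x
  proof -
    obtain y where y: "x = \<psi> y" using tube_map_surj[OF pos, of k x, symmetric] unfolding \<psi>_def by blast
    then have "y \<notin> K" using that by blast
    from K(2)[OF this] show ?thesis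
      unfolding y f_def \<psi>_def tube_fun_tube_map[OF pos] by (simp only: of_real_0)
  qed
  have KU: "\<psi> ` K \<subseteq> {x. 0 < q x \<and> q x < R}" using U by (auto simp: \<psi>_def)
  have cK: "compact (\<psi> ` K)" by (intro compact_continuous_image c\<psi> K)
  have closure: "closure {x. f x \<noteq> 0} \<subseteq> \<psi> ` K"
    using f0 by (intro closure_minimal compact_imp_closed[OF cK]) blast
  have test: "test_fun q R f"
    unfolding test_fun_def
  proof (intro conjI)
    show "smooth_fun f" unfolding f_def by (intro smooth_fun_tube_fun G)
    show "compact (closure {x. f x \<noteq> 0})"
      using compact_Int_closed[OF cK closed_closure, of "{x. f x \<noteq> 0}"] closure
      by (simp only: Int_absorb1)
    show "closure {x. f x \<noteq> 0} \<subseteq> {x. q x < R} - {0}"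
    proof
      fix x assume "x \<in> closure {x. f x \<noteq> 0}"
      then have "0 < q x \<and> q x < R" using closure KU by blast
      then show "x \<in> {x. q x < R} - {0}" using q_eq_0[of 0] by auto
    qed
  qed
  obtain K' where K': "compact K'" "K' \<subseteq> {x. 0 < q x \<and> q x < R}" "\<And>x. x \<notin> K' \<Longrightarrow> f x = 0"
    "\<And>x. x \<notin> K' \<Longrightarrow> euler_deriv f x = 0" "\<And>x. f differentiable at x"
    "continuous_on UNIV f" "continuous_on UNIV (euler_deriv f)"
    using test_fun_support[OF test] by metis
  have f: "f \<in> borel_measurable borel" and e: "euler_deriv f \<in> borel_measurable borel"
    using K'(6,7) by (auto intro: borel_measurable_continuous_onI)
  have transfer: "wint q R a b u = J * (LBINT y. u (\<psi> y) / (q (\<psi> y) powr a * logw q R (\<psi> y) powr b))"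
    if "u \<in> borel_measurable borel" "\<And>x. x \<notin> K' \<Longrightarrow> u x = 0" for u a b
  proof -
    have "wint q R a b u = (LBINT x. u x / (q x powr a * logw q R x powr b))"
      by (rule wint_eq_lborel[OF K'(1,2)]) (use that in auto)
    also have "\<dots> = J * (LBINT y. u (\<psi> y) / (q (\<psi> y) powr a * logw q R (\<psi> y) powr b))"
      unfolding J_def \<psi>_def tube_map_def
      by (rule lborel_integral_diagonal_affine) (use that(1) weight_measurable pos in auto)
    finally show ?thesis .
  qed
  have "wint q R a b (\<lambda>x. cmod (f x) powr p)
      = J * (LBINT y. \<bar>\<Prod>i\<in>UNIV. G i (y $ i)\<bar> powr p / (q (\<psi> y) powr a * logw q R (\<psi> y) powr b))" for a b
  proof -
    have "(\<lambda>x. cmod (f x) powr p) \<in> borel_measurable borel" using f by simp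
    from transfer[OF this] show ?thesis
      using K'(3) by (simp add: f_def \<psi>_def tube_fun_tube_map[OF pos] del: of_real_prod)
  qed
  moreover have "wint q R \<alpha> b (\<lambda>x. cmod (radial_deriv \<nu> q f x) powr p)
      = J * (LBINT y. \<bar>\<Sum>i\<in>UNIV. \<nu> i * (if i = k then y $ i - m else y $ i) * partial_tensor G G' i y\<bar> powr p
          / (q (\<psi> y) powr (\<alpha> + p) * logw q R (\<psi> y) powr b))" for \<alpha> b
  proof -
    have "(\<lambda>x. cmod (radial_deriv \<nu> q f x) powr p) \<in> borel_measurable borel"
      unfolding radial_deriv_eq[OF K'(5)] using e by measurable
    moreover have "cmod (radial_deriv \<nu> q f x) powr p = 0" if "x \<notin> K'" for x
      unfolding radial_deriv_eq[OF K'(5)] using K'(4)[OF that] by simp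
    ultimately have "wint q R \<alpha> b (\<lambda>x. cmod (radial_deriv \<nu> q f x) powr p)
      = J * (LBINT y. cmod (radial_deriv \<nu> q f (\<psi> y)) powr p / (q (\<psi> y) powr \<alpha> * logw q R (\<psi> y) powr b))"
      by (rule transfer)
    moreover have "cmod (radial_deriv \<nu> q f (\<psi> y)) powr p / (q (\<psi> y) powr \<alpha> * w)
        = \<bar>\<Sum>i\<in>UNIV. \<nu> i * (if i = k then y $ i - m else y $ i) * partial_tensor G G' i y\<bar> powr p
          / (q (\<psi> y) powr (\<alpha> + p) * w)" for y w
      unfolding radial_deriv_eq[OF K'(5)] unfolding f_def \<psi>_def euler_deriv_tube_fun[OF G(2) pos]
      using q_nonneg[of "tube_map k c m \<delta> y"]
      by (simp add: norm_divide powr_divide powr_add mult_ac del: of_real_sum)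
    ultimately show ?thesis by simp
  qed
  ultimately show ?thesis using that J test by blast
qed

text \<open>Both bounds are ln t \<le> t - 1, at t = 1 - u and at t = 1/(1 - u).\<close>

lemma minus_ln_one_minus_bounds:
  fixes u :: real
  assumes "0 < u" "u < 1"
  shows "u \<le> - ln (1 - u)" "- ln (1 - u) \<le> u / (1 - u)"
proof -
  show "u \<le> - ln (1 - u)" using ln_le_minus_one[of "1 - u"] assms by simp
  have "ln (1 / (1 - u)) \<le> 1 / (1 - u) - 1" using ln_le_minus_one[of "1 / (1 - u)"] assms by simp
  moreover have "1 / (1 - u) - 1 = u / (1 - u)" using assms by (simp add: field_simps)
  ultimately show "- ln (1 - u) \<le> u / (1 - u)" using assms by (simp add: ln_div)
qed

section \<open>The quasi-norm near an axis\<close>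

context homogeneous_norm
begin

text \<open>Each positive axis point is a dilate of \<open>axis k 1\<close>, which makes
  \<open>q\<close> explicit there; \<open>c\<close> is normalised so that r = 1 lands on the
  sphere.\<close>

lemma q_axis:
  fixes r R :: real and k :: 'n
  assumes "0 < r" "0 < R"
  defines "c \<equiv> (R / q (axis k 1)) powr \<nu> k"
  shows "q (axis k (c * r)) = R * r powr (1 / \<nu> k)" "0 < c"
proof -
  have "q (axis k 1) \<noteq> 0" unfolding q_eq_0 by (simp add: axis_eq_0_iff)
  then have q1: "0 < q (axis k 1)" using q_nonneg[of "axis k 1"] by linarith
  show c: "0 < c" using q1 assms(2) by (simp add: c_def)
  have nu: "\<nu> k \<noteq> 0" using nu_pos[of k] by simp
  have "axis k (c * r) = dil \<nu> ((c * r) powr (1 / \<nu> k)) (axis k 1)"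
    using c assms(1) nu by (simp add: vec_eq_iff dil_def axis_nth_if powr_powr)
  then have "q (axis k (c * r)) = (c * r) powr (1 / \<nu> k) * q (axis k 1)"
    using c assms(1) by (simp add: q_dil)
  also have "\<dots> = R * r powr (1 / \<nu> k)"
    using c q1 assms(1,2) nu by (simp add: powr_mult c_def powr_powr)
  finally show "q (axis k (c * r)) = R * r powr (1 / \<nu> k)" .
qed

text \<open>Shrinking the tube around the axis makes the quasi-norm on it uniformly close to its values
  on the axis, although nothing but continuity of the quasi-norm is known.\<close>
lemma thin_tube:
  fixes k :: 'n
  assumes c: "0 < c" and m: "0 < m" and K: "compact K" "\<And>y. y \<in> K \<Longrightarrow> y $ k < m" and e: "0 < e"
  obtains \<delta> where "0 < \<delta>" "\<And>y. y \<in> K \<Longrightarrow> 0 < q (tube_map k c m \<delta> y)"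
    "\<And>y. y \<in> K \<Longrightarrow> \<bar>ln (q (tube_map k c m \<delta> y)) - ln (q (axis k (c * (1 - y $ k / m))))\<bar> \<le> e"
proof -
  define Q where "Q z = q (tube_map k c m (fst z) (snd z))" for z
  \<comment> \<open>The k-th coordinate does not depend on the width and stays positive, so the tube
    avoids the origin and \<open>ln\<close> of the quasi-norm is continuous.\<close>
  have pos: "0 < q (tube_map k c m d y)" if "y \<in> K" for d y
  proof -
    have "tube_map k c m d y $ k = c * (1 - y $ k / m)"
      by (simp add: tube_map_def right_diff_distrib)
    moreover have "0 < c * (1 - y $ k / m)" using c m K(2)[OF that] by simp
    ultimately have "tube_map k c m d y \<noteq> 0" by (metis less_irrefl zero_index)
    then show ?thesis using q_eq_0 q_nonneg by (metis less_le)
  qed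
  have "continuous_on ({0..1} \<times> K) Q"
    unfolding Q_def
    by (rule continuous_on_compose2[OF q_cont continuous_on_tube_map]) simp
  moreover have "Q z \<noteq> 0" if "z \<in> {0..1} \<times> K" for z
    using pos[of "snd z" "fst z"] that unfolding Q_def by force
  ultimately have "continuous_on ({0..1} \<times> K) (\<lambda>z. ln (Q z))"
    by (intro continuous_on_ln) auto
  \<comment> \<open>The width is treated as a variable in [0, 1], with 0 giving the axis itself;
    compactness makes the comparison with width 0 uniform in y.\<close>
  then have "uniformly_continuous_on ({0..1} \<times> K) (\<lambda>z. ln (Q z))"
    by (intro compact_uniformly_continuous compact_Times K compact_Icc)
  then obtain d where d: "0 < d" "\<And>z z'. z \<in> {0..1} \<times> K \<Longrightarrow> z' \<in> {0..1} \<times> K \<Longrightarrow> dist z' z < d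
      \<Longrightarrow> dist (ln (Q z')) (ln (Q z)) < e"
    unfolding uniformly_continuous_on_def using e by metis
  define \<delta> where "\<delta> = min 1 (d / 2)"
  have \<delta>: "0 < \<delta>" "\<delta> \<le> 1" "\<delta> < d" using d(1) by (auto simp: \<delta>_def)
  have axis: "tube_map k c m 0 y = axis k (c * (1 - y $ k / m))" for y
    by (simp add: tube_map_def vec_eq_iff axis_nth_if right_diff_distrib)
  have "\<bar>ln (q (tube_map k c m \<delta> y)) - ln (q (axis k (c * (1 - y $ k / m))))\<bar> \<le> e" if "y \<in> K" for y
    using d(2)[of "(0, y)" "(\<delta>, y)"] \<delta> that by (simp add: Q_def dist_Pair_Pair dist_real_def axis)
  then show ?thesis using that \<delta>(1) pos by blast
qed

end

lemma partial_tensor_eq_0: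
  assumes "\<And>i s. s \<notin> {lo i..hi i} \<Longrightarrow> G i s = 0" "\<And>i s. s \<notin> {lo i..hi i} \<Longrightarrow> G' i s = 0"
    and "y \<notin> cbox (\<chi> i. lo i) (\<chi> i. hi i)"
  shows "(\<Prod>i\<in>UNIV. G i (y $ i)) = 0" "partial_tensor G G' i y = 0"
proof -
  obtain j where j: "y $ j \<notin> {lo j..hi j}" using assms(3) by (auto simp: mem_box_cart)
  then show "(\<Prod>i\<in>UNIV. G i (y $ i)) = 0" using assms(1) by (intro prod_zero) auto
  have "(G(i := G' i)) j (y $ j) = 0" using j assms(1,2) by auto
  then show "partial_tensor G G' i y = 0"
    unfolding partial_tensor_def by (intro prod_zero bexI[of _ j]) auto
qed

lemma continuous_on_partial_tensor:
  assumes "\<And>i. continuous_on UNIV (G i)" "\<And>i. continuous_on UNIV (G' i)"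
  shows "continuous_on S (\<lambda>y. \<Prod>i\<in>UNIV. G i (y $ i))" "continuous_on S (partial_tensor G G' i)"
proof -
  have "continuous_on S (\<lambda>y. u (y $ j))" if "continuous_on UNIV u" for u :: "real \<Rightarrow> real" and j :: 'a
    by (rule continuous_on_compose2[OF that]) (auto intro!: continuous_intros)
  then show "continuous_on S (\<lambda>y. \<Prod>i\<in>UNIV. G i (y $ i))" "continuous_on S (partial_tensor G G' i)"
    unfolding partial_tensor_def using assms by (auto intro!: continuous_on_prod)
qed

section \<open>The optimal constant\<close>

context homogeneous_norm
begin

text \<open>The profile is strict for the half-line inequality with constant C. In tube coordinates,
  after division by a common power of m, both sides of the full inequality converge to the half-line
  integrals times one positive factor, so strictness holds for some finite m.\<close>

lemma hardy_constant_sharp: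
  fixes \<alpha> \<beta> p C R :: real
  assumes R: "0 < R" and p: "1 < p" and C: "\<bar>(\<beta> + p) / p\<bar> powr p < C"
  shows "\<exists>f. test_fun q R f \<and> wint q R \<alpha> (\<beta> + 1) (\<lambda>x. cmod (radial_deriv \<nu> q f x) powr p)
    < C * wint q R (\<alpha> + p) (\<beta> + p + 1) (\<lambda>x. cmod (f x) powr p)"
proof -
  define k :: 'n where "k = undefined"
  have \<kappa>: "\<beta> + p = (\<beta> + p) / p * p" using p by simp
  obtain g g' a b where ab: "0 < a" "a \<le> b" and g: "smooth_real g" "\<And>s. (g has_real_derivative g' s) (at s)"
    "continuous_on UNIV g'" "\<And>s. s \<notin> {a..b} \<Longrightarrow> g s = 0" "\<And>s. s \<notin> {a..b} \<Longrightarrow> g' s = 0"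
    and profile: "(LBINT s. \<bar>g' s\<bar> powr p * s powr (- \<beta> - 1)) < C * (LBINT s. \<bar>g s\<bar> powr p * s powr (- \<beta> - p - 1))"
    by (rule hardy_profile[OF p \<kappa> C]) blast
  obtain bump' where bump': "smooth_real bump'" "\<And>x. (bump has_real_derivative bump' x) (at x)"
    using smooth_realE[OF smooth_real_bump] by blast
  have b0: "bump x = 0" if "x \<notin> {0..1}" for x using that by (intro bump_eq_0) auto
  have b'0: "bump' x = 0" if "x \<notin> {0..1}" for x
    using compact_support_deriv_0[OF bump'(2) b0 that] .
  define G G' where "G i = (if i = k then g else bump)" and "G' i = (if i = k then g' else bump')" for i
  define lo hi where "lo i = (if i = k then a else 0)" and "hi i = (if i = k then b else 1)" for i
  define K :: "(real^'n) set" where "K = cbox (\<chi> i. lo i) (\<chi> i. hi i)"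
  have G: "smooth_real (G i)" "(G i has_real_derivative G' i x) (at x)"
    "continuous_on UNIV (G i)" "continuous_on UNIV (G' i)" for i x
    using g bump' smooth_real_bump by (auto simp: G_def G'_def smooth_real_continuous)
  have G0: "G i s = 0" "G' i s = 0" if "s \<notin> {lo i..hi i}" for i s
    using that g(4,5)[of s] b0[of s] b'0[of s] by (auto simp: G_def G'_def lo_def hi_def split: if_splits)
  have K: "compact K" by (simp add: K_def compact_cbox)
  have yk: "a \<le> y $ k" "y $ k \<le> b" if "y \<in> K" for y
    using that by (auto simp: K_def mem_box_cart lo_def hi_def split: if_splits dest: spec[of _ k])
  define F where "F y = (\<Prod>i\<in>UNIV. G i (y $ i))" for y :: "real^'n"
  define P where "P i y = partial_tensor G G' i y" for i :: 'n and y :: "real^'n"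
  have F0: "F y = 0" and P0: "P i y = 0" if "y \<notin> K" for y i
    using partial_tensor_eq_0[OF G0] that by (auto simp: F_def P_def K_def)
  have cF: "continuous_on S F" and cP: "continuous_on S (P i)" for S i
    using continuous_on_partial_tensor[of G G', OF G(3,4)] by (auto simp: F_def[abs_def] P_def[abs_def])
  define c where "c = (R / q (axis k 1)) powr \<nu> k"
  have axis: "q (axis k (c * r)) = R * r powr (1 / \<nu> k)" if "0 < r" for r
    using q_axis(1)[OF that R, of k] by (simp add: c_def)
  have c: "0 < c" using q_axis(2)[of 1 R k] R by (simp add: c_def)
  have nu: "0 < \<nu> k" by (rule nu_pos)
  \<comment> \<open>The first bound keeps \<open>y $ k / m\<close> below 1/2 on the support; the
    second makes 1/m at most a / (2 \<nu>_k), half of the least limiting value of the rescaled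
    logarithm.\<close>
  define M where "M = max (2 * b + 1) (2 * \<nu> k / a)"
  define m where "m n = M + real n" for n
  have M: "1 \<le> M" "2 * b < M" "2 * \<nu> k / a \<le> M" using ab by (auto simp: M_def)
  have m: "1 \<le> m n" "2 * b < m n" "2 * \<nu> k / a \<le> m n" "M \<le> m n" for n using M by (auto simp: m_def)
  have m0: "0 < m n" for n using m(1)[of n] by linarith
  have m_lim: "(\<lambda>n. inverse (m n)) \<longlonglongrightarrow> 0"
    unfolding m_def
    by (intro tendsto_inverse_0_at_top filterlim_tendsto_add_at_top[OF tendsto_const] filterlim_real_sequentially)
  \<comment> \<open>The tolerance 1/m^2 is needed because \<open>logw\<close> itself is of order
    1/m: after rescaling by m an error 1/m remains, which tends to 0.\<close>
  have "\<exists>\<delta>>0. \<forall>y\<in>K. 0 < q (tube_map k c (m n) \<delta> y) \<and>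
      \<bar>ln (q (tube_map k c (m n) \<delta> y)) - ln (q (axis k (c * (1 - y $ k / m n))))\<bar> \<le> inverse (m n) * inverse (m n)" for n
  proof -
    have "y $ k < m n" if "y \<in> K" for y using yk[OF that] m(2)[of n] ab by linarith
    moreover have "0 < inverse (m n) * inverse (m n)" using m0[of n] by simp
    ultimately show ?thesis
      using thin_tube[OF c m0[of n] K, of k "inverse (m n) * inverse (m n)"] by metis
  qed
  then obtain \<delta> where \<delta>: "\<And>n. 0 < \<delta> n" "\<And>n y. y \<in> K \<Longrightarrow> 0 < q (tube_map k c (m n) (\<delta> n) y)"
    "\<And>n y. y \<in> K \<Longrightarrow> \<bar>ln (q (tube_map k c (m n) (\<delta> n) y)) - ln (q (axis k (c * (1 - y $ k / m n))))\<bar>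
      \<le> inverse (m n) * inverse (m n)"
    by metis
  define \<psi> where "\<psi> n = tube_map k c (m n) (\<delta> n)" for n
  \<comment> \<open>The logarithm at its natural scale; its limit is
    \<open>y $ k / \<nu> k\<close>.\<close>
  define L where "L n y = m n * logw q R (\<psi> n y)" for n y
  define lower where "lower n s = s / \<nu> k - inverse (m n)" for n s
  define upper where "upper n s = s * inverse (1 - s * inverse (m n)) / \<nu> k + inverse (m n)" for n s
  have L_bounds: "lower n (y $ k) \<le> L n y" "L n y \<le> upper n (y $ k)" if y: "y \<in> K" for n y
  proof -
    define s u where "s = y $ k" and "u = s / m n"
    have s: "a \<le> s" "s \<le> b" using yk[OF y] by (auto simp: s_def)
    have u: "0 < u" "u < 1" using s ab m(2)[of n] m0[of n] by (auto simp: u_def)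
    have "ln (q (axis k (c * (1 - u)))) = ln R + ln (1 - u) / \<nu> k"
      using axis[of "1 - u"] u R by (simp add: ln_mult ln_powr)
    then have "\<bar>logw q R (\<psi> n y) - (- ln (1 - u) / \<nu> k)\<bar> \<le> inverse (m n) * inverse (m n)"
      using \<delta>(3)[OF y, of n] \<delta>(2)[OF y, of n] R by (simp add: logw_def \<psi>_def ln_div u_def s_def abs_minus_commute)
    then have "m n * \<bar>logw q R (\<psi> n y) - (- ln (1 - u) / \<nu> k)\<bar> \<le> inverse (m n)"
      using m0[of n] by (simp add: field_simps)
    then have near: "\<bar>L n y - m n * (- ln (1 - u) / \<nu> k)\<bar> \<le> inverse (m n)"
      unfolding L_def right_diff_distrib[symmetric] abs_mult using m0[of n] by (simp only: abs_of_pos)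
    have "m n * (u / \<nu> k) \<le> m n * (- ln (1 - u) / \<nu> k)"
      using minus_ln_one_minus_bounds(1)[OF u] m0[of n] nu
      by (intro mult_left_mono divide_right_mono) auto
    moreover have "m n * (u / \<nu> k) = s / \<nu> k" using m0[of n] by (simp add: u_def)
    moreover have "m n * (- ln (1 - u) / \<nu> k) \<le> m n * (u / (1 - u) / \<nu> k)"
      using minus_ln_one_minus_bounds(2)[OF u] m0[of n] nu
      by (intro mult_left_mono divide_right_mono) auto
    moreover have "m n * (u / (1 - u) / \<nu> k) = s * inverse (1 - s * inverse (m n)) / \<nu> k"
      using m0[of n] by (simp add: u_def divide_inverse)
    ultimately show "lower n (y $ k) \<le> L n y" "L n y \<le> upper n (y $ k)"
      using near unfolding lower_def upper_def s_def[symmetric] by linarith+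
  qed
  define l0 l1 where "l0 = a / (2 * \<nu> k)" and "l1 = 2 * b / \<nu> k + 1"
  have l0: "0 < l0" using ab nu by (simp add: l0_def)
  have inv_m: "0 < inverse (m n)" "inverse (m n) \<le> l0" "inverse (m n) \<le> 1" for n
  proof -
    have "inverse (m n) \<le> inverse (2 * \<nu> k / a)"
      using m(3)[of n] nu ab by (intro le_imp_inverse_le) auto
    then show "inverse (m n) \<le> l0" by (simp add: l0_def)
    show "0 < inverse (m n)" "inverse (m n) \<le> 1" using m0[of n] m(1)[of n] by (auto simp: inverse_le_1_iff)
  qed
  have L_range: "l0 \<le> L n y \<and> L n y \<le> l1" if y: "y \<in> K" for n y
  proof
    have "a / \<nu> k \<le> y $ k / \<nu> k" using yk[OF y] nu by (simp add: divide_right_mono)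
    moreover have "a / \<nu> k = l0 + l0" using nu by (simp add: l0_def field_simps)
    ultimately show "l0 \<le> L n y" using L_bounds(1)[OF y, of n] inv_m(2)[of n] by (simp add: lower_def)
    have "y $ k * inverse (m n) \<le> 1 / 2"
      using yk[OF y] m(2)[of n] m0[of n] by (simp add: field_simps)
    then have "inverse (1 - y $ k * inverse (m n)) \<le> inverse (1 / 2)"
      by (intro le_imp_inverse_le) auto
    then have "y $ k * inverse (1 - y $ k * inverse (m n)) \<le> b * 2"
      using yk[OF y] ab \<open>y $ k * inverse (m n) \<le> 1 / 2\<close> by (intro mult_mono) auto
    then have "y $ k * inverse (1 - y $ k * inverse (m n)) / \<nu> k \<le> b * 2 / \<nu> k"
      using nu by (intro divide_right_mono) auto
    then show "L n y \<le> l1" using L_bounds(2)[OF y, of n] inv_m(3)[of n] by (simp add: upper_def l1_def mult.commute)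
  qed
  have L_lim: "(\<lambda>n. L n y) \<longlonglongrightarrow> y $ k / \<nu> k" if y: "y \<in> K" for y
  proof (rule tendsto_sandwich[OF always_eventually always_eventually])
    show "\<forall>n. lower n (y $ k) \<le> L n y" "\<forall>n. L n y \<le> upper n (y $ k)" using L_bounds[OF y] by auto
    have "(\<lambda>n. lower n (y $ k)) \<longlonglongrightarrow> y $ k / \<nu> k - 0"
      unfolding lower_def by (intro tendsto_intros m_lim)
    then show "(\<lambda>n. lower n (y $ k)) \<longlonglongrightarrow> y $ k / \<nu> k" by simp
    have "(\<lambda>n. upper n (y $ k)) \<longlonglongrightarrow> y $ k * inverse (1 - y $ k * 0) / \<nu> k + 0"
      unfolding upper_def using nu by (intro tendsto_intros m_lim) auto
    then show "(\<lambda>n. upper n (y $ k)) \<longlonglongrightarrow> y $ k / \<nu> k" by simp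
  qed
  have logw_eq: "logw q R (\<psi> n y) = inverse (m n) * L n y" for n y
    using m0[of n] by (simp add: L_def)
  have q_eq: "q (\<psi> n y) = R * exp (- (inverse (m n) * L n y))" if y: "y \<in> K" for n y
    using \<delta>(2)[OF y, of n] R unfolding logw_eq[symmetric] by (simp add: logw_def \<psi>_def exp_minus)
  have q_range: "R * exp (- l1) \<le> q (\<psi> n y) \<and> q (\<psi> n y) \<le> R" and q_less: "q (\<psi> n y) < R" if y: "y \<in> K" for n y
  proof -
    have "0 < L n y" using L_range[OF y, of n] l0 by linarith
    moreover have "inverse (m n) * L n y \<le> 1 * l1"
      using inv_m[of n] L_range[OF y, of n] \<open>0 < L n y\<close> by (intro mult_mono) auto
    ultimately show "R * exp (- l1) \<le> q (\<psi> n y) \<and> q (\<psi> n y) \<le> R" "q (\<psi> n y) < R"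
      unfolding q_eq[OF y] using R inv_m(1)[of n] by auto
  qed
  have q_lim: "(\<lambda>n. q (\<psi> n y)) \<longlonglongrightarrow> R" if y: "y \<in> K" for y
  proof -
    have "(\<lambda>n. R * exp (- (inverse (m n) * L n y))) \<longlonglongrightarrow> R * exp (- (0 * (y $ k / \<nu> k)))"
      by (intro tendsto_intros m_lim L_lim y)
    then show ?thesis using q_eq[OF y] by simp
  qed
  have m\<psi>: "\<psi> n \<in> borel \<rightarrow>\<^sub>M borel" for n
  proof -
    have "continuous_on UNIV (\<lambda>y::real^'n. (\<delta> n, y))"
      by (intro continuous_on_Pair continuous_on_const continuous_on_id)
    from continuous_on_compose2[OF continuous_on_tube_map[of UNIV] this]
    show ?thesis unfolding \<psi>_def by (intro borel_measurable_continuous_onI) simp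
  qed
  have mq: "(\<lambda>y. q (\<psi> n y)) \<in> borel_measurable borel" for n
    using measurable_compose[OF m\<psi> q_measurable] .
  have mL: "L n \<in> borel_measurable borel" for n
    unfolding L_def logw_def using mq by measurable
  define E where "E n y = (\<Sum>i\<in>UNIV. \<nu> i * (if i = k then y $ i - m n else y $ i) * P i y)" for n y
  \<comment> \<open>The Euler derivative divided by m: its transversal terms tend to 0 and its axial
    term to minus \<nu>_k times the partial derivative along the axis.\<close>
  define E' where "E' n y = (\<Sum>i\<in>UNIV. \<nu> i * (if i = k then y $ i * inverse (m n) - 1 else y $ i * inverse (m n)) * P i y)" for n y
  have E_E': "E n y = m n * E' n y" for n y
    unfolding E_def E'_def sum_distrib_left using m0[of n]
    by (intro sum.cong) (auto simp: field_simps)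
  have cE': "continuous_on S (E' n)" for S n
    unfolding E'_def
  proof (intro continuous_on_sum continuous_on_mult continuous_on_const cP)
    show "continuous_on S (\<lambda>y. if i = k then y $ i * inverse (m n) - 1 else y $ i * inverse (m n))" for i
      using inv_m(1)[of n] by (cases "i = k") (auto intro!: continuous_intros)
  qed
  have lim_F: "(\<lambda>n. LBINT y. \<bar>F y\<bar> powr p / (q (\<psi> n y) powr (\<alpha> + p) * L n y powr (\<beta> + p + 1)))
      \<longlonglongrightarrow> (LBINT y. \<bar>F y\<bar> powr p / (R powr (\<alpha> + p) * (y $ k / \<nu> k) powr (\<beta> + p + 1)))"
  proof (rule weighted_dominated_convergence[where h = "\<lambda>_ y. \<bar>F y\<bar> powr p" and Q = "\<lambda>n y. q (\<psi> n y)"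
        and ?q1.0 = R and ?l0.0 = l0 and ?l1.0 = l1 and H = "\<lambda>y. \<bar>F y\<bar> powr p", OF _ mq mL K])
    show "continuous_on K (\<lambda>y. \<bar>F y\<bar> powr p)"
      using p by (intro continuous_on_powr' continuous_intros cF) auto
    show "(\<lambda>y. \<bar>F y\<bar> powr p) \<in> borel_measurable borel" for n :: nat
      using borel_measurable_continuous_onI[OF cF] by simp
    show "0 < R * exp (- l1)" using R by simp
  qed (use F0 l0 q_range L_range q_lim L_lim in auto)
  have lim_E: "(\<lambda>n. LBINT y. \<bar>E' n y\<bar> powr p / (q (\<psi> n y) powr (\<alpha> + p) * L n y powr (\<beta> + 1)))
      \<longlonglongrightarrow> (LBINT y. \<bar>\<nu> k * P k y\<bar> powr p / (R powr (\<alpha> + p) * (y $ k / \<nu> k) powr (\<beta> + 1)))"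
  proof (rule weighted_dominated_convergence[where h = "\<lambda>n y. \<bar>E' n y\<bar> powr p" and Q = "\<lambda>n y. q (\<psi> n y)"
        and ?q1.0 = R and ?l0.0 = l0 and ?l1.0 = l1 and H = "\<lambda>y. (\<Sum>i\<in>UNIV. \<nu> i * (\<bar>y $ i\<bar> + 1) * \<bar>P i y\<bar>) powr p", OF _ mq mL K])
    show "continuous_on K (\<lambda>y. (\<Sum>i\<in>UNIV. \<nu> i * (\<bar>y $ i\<bar> + 1) * \<bar>P i y\<bar>) powr p)"
    proof (intro continuous_on_powr' continuous_on_const ballI conjI impI)
      show "continuous_on K (\<lambda>y. \<Sum>i\<in>UNIV. \<nu> i * (\<bar>y $ i\<bar> + 1) * \<bar>P i y\<bar>)"
        by (intro continuous_intros cP)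
      show "0 \<le> (\<Sum>i\<in>UNIV. \<nu> i * (\<bar>y $ i\<bar> + 1) * \<bar>P i y\<bar>)" for y
        using nu_pos by (intro sum_nonneg mult_nonneg_nonneg) (auto intro: less_imp_le)
    qed (use p in auto)
    show "(\<lambda>y. \<bar>E' n y\<bar> powr p) \<in> borel_measurable borel" for n
      using borel_measurable_continuous_onI[OF cE'] by simp
    show "0 < R * exp (- l1)" using R by simp
    show "\<bar>\<bar>E' n y\<bar> powr p\<bar> \<le> (\<Sum>i\<in>UNIV. \<nu> i * (\<bar>y $ i\<bar> + 1) * \<bar>P i y\<bar>) powr p" for n y
    proof -
      have t: "\<bar>y $ i * inverse (m n)\<bar> \<le> \<bar>y $ i\<bar>" for i
        using inv_m[of n] by (simp add: abs_mult mult_left_le)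
      have "\<bar>E' n y\<bar> \<le> (\<Sum>i\<in>UNIV. \<nu> i * (\<bar>y $ i\<bar> + 1) * \<bar>P i y\<bar>)"
        unfolding E'_def
      proof (rule order_trans[OF sum_abs sum_mono])
        fix i
        have "\<bar>if i = k then y $ i * inverse (m n) - 1 else y $ i * inverse (m n)\<bar> \<le> \<bar>y $ i\<bar> + 1"
          using t[of i] by auto
        then show "\<bar>\<nu> i * (if i = k then y $ i * inverse (m n) - 1 else y $ i * inverse (m n)) * P i y\<bar>
            \<le> \<nu> i * (\<bar>y $ i\<bar> + 1) * \<bar>P i y\<bar>"
          using nu_pos[of i] by (simp only: abs_mult) (intro mult_mono; simp)
      qed
      then show ?thesis using p by (simp add: powr_mono2)
    qed
    show "(\<lambda>n. \<bar>E' n y\<bar> powr p) \<longlonglongrightarrow> \<bar>\<nu> k * P k y\<bar> powr p" for y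
    proof -
      have "(\<lambda>n. E' n y) \<longlonglongrightarrow> (\<Sum>i\<in>UNIV. \<nu> i * (if i = k then -1 else 0) * P i y)"
        unfolding E'_def
      proof (intro tendsto_sum tendsto_mult tendsto_const)
        fix i
        have l: "(\<lambda>n. y $ i * inverse (m n)) \<longlonglongrightarrow> 0"
          using tendsto_mult[OF tendsto_const[of "y $ i"] m_lim] by simp
        have "(\<lambda>n. y $ i * inverse (m n) - 1) \<longlonglongrightarrow> -1"
          using tendsto_diff[OF l tendsto_const[of 1]] by simp
        with l show "(\<lambda>n. if i = k then y $ i * inverse (m n) - 1 else y $ i * inverse (m n))
            \<longlonglongrightarrow> (if i = k then -1 else 0)"
          by (cases "i = k") (simp_all only: if_True if_False simp_thms)
      qed
      also have "(\<Sum>i\<in>UNIV. \<nu> i * (if i = k then -1 else 0) * P i y) = - (\<nu> k * P k y)"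
        by (simp add: if_distrib[of "\<lambda>x. _ * x"] if_distrib[of "\<lambda>x. x * _"] cong: if_cong)
      finally have "(\<lambda>n. \<bar>E' n y\<bar>) \<longlonglongrightarrow> \<bar>- (\<nu> k * P k y)\<bar>" by (rule tendsto_rabs)
      from tendsto_powr'[OF this tendsto_const[of p]] show ?thesis using p by simp
    qed
    show "\<bar>E' n y\<bar> powr p = 0" if "y \<notin> K" for n y
      unfolding E'_def using P0[OF that] by simp
    show "\<bar>\<nu> k * P k y\<bar> powr p = 0" if "y \<notin> K" for y
      using P0[OF that] by simp
  qed (use l0 q_range L_range q_lim L_lim in auto)
  \<comment> \<open>The common factor of both limits: the factor |\<nu>_k|^p of the derivative makes
    up for the difference between the logarithmic exponents \<beta> + 1 and \<beta> + p + 1.\<close>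
  define W where "W = \<nu> k powr (\<beta> + p + 1) / R powr (\<alpha> + p)"
  define B where "B = (\<Prod>i\<in>UNIV - {k}. LBINT s. bump s powr p)"
  have W: "0 < W" using nu R by (simp add: W_def)
  have B: "0 < B" unfolding B_def using bump_powr_integral(2) p by (intro prod_pos) auto
  have tensor: "(LBINT y::real^'n. \<Prod>i\<in>UNIV. (if i = k then u else (\<lambda>s. bump s powr p)) (y $ i)) = (LBINT s. u s) * B"
    if "integrable lborel u" "\<And>s. 0 \<le> u s" for u
  proof -
    have "(LBINT y::real^'n. \<Prod>i\<in>UNIV. (if i = k then u else (\<lambda>s. bump s powr p)) (y $ i))
        = (\<Prod>i\<in>UNIV. LBINT s. (if i = k then u else (\<lambda>s. bump s powr p)) s)"
      by (rule lborel_integral_tensor) (use that bump_powr_integral(1) p in auto)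
    also have "\<dots> = (LBINT s. u s) * B"
      unfolding B_def by (subst prod.remove[of _ k]) (auto intro!: prod.cong)
    finally show ?thesis .
  qed
  have abs_prod_powr: "\<bar>\<Prod>j\<in>UNIV. w j\<bar> powr p = (\<Prod>j\<in>UNIV. \<bar>w j\<bar> powr p)" for w :: "'n \<Rightarrow> real"
    by (simp add: abs_prod prod_powr_distrib)
  have int: "integrable lborel (\<lambda>s. \<bar>u s\<bar> powr p * s powr r)"
    if "continuous_on UNIV u" "\<And>s. s \<notin> {a..b} \<Longrightarrow> u s = 0" for u :: "real \<Rightarrow> real" and r
    using that ab p
    by (intro integrable_lborel_compact_support[OF compact_Icc[of a b]] continuous_on_mult continuous_on_powr'
        continuous_on_rabs continuous_on_const continuous_on_id continuous_on_subset[OF that(1)]) auto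
  have I_F: "(LBINT y. \<bar>F y\<bar> powr p / (R powr (\<alpha> + p) * (y $ k / \<nu> k) powr (\<beta> + p + 1)))
      = W * ((LBINT s. \<bar>g s\<bar> powr p * s powr (- \<beta> - p - 1)) * B)"
  proof -
    have "\<bar>F y\<bar> powr p / (R powr (\<alpha> + p) * (y $ k / \<nu> k) powr (\<beta> + p + 1))
        = W * (\<Prod>i\<in>UNIV. (if i = k then (\<lambda>s. \<bar>g s\<bar> powr p * s powr (- \<beta> - p - 1)) else (\<lambda>s. bump s powr p)) (y $ i))" for y
    proof (cases "y \<in> K")
      case True
      then have y: "0 < y $ k" using yk ab by force
      have "(y $ k) powr (- \<beta> - p - 1) = 1 / (y $ k) powr (\<beta> + p + 1)"
        by (simp add: powr_minus_divide[symmetric] diff_diff_eq)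
      moreover have "\<bar>F y\<bar> powr p = \<bar>g (y $ k)\<bar> powr p * (\<Prod>i\<in>UNIV - {k}. bump (y $ i) powr p)"
        unfolding F_def abs_prod_powr using bump_nonneg
        by (subst prod.remove[of _ k]) (auto simp: G_def intro!: prod.cong)
      moreover have "(\<Prod>i\<in>UNIV. (if i = k then (\<lambda>s. \<bar>g s\<bar> powr p * s powr (- \<beta> - p - 1)) else (\<lambda>s. bump s powr p)) (y $ i))
          = \<bar>g (y $ k)\<bar> powr p * (y $ k) powr (- \<beta> - p - 1) * (\<Prod>i\<in>UNIV - {k}. bump (y $ i) powr p)"
        by (subst prod.remove[of _ k]) (auto intro!: prod.cong)
      ultimately show ?thesis
        using y nu by (simp add: W_def powr_divide)
    next
      case False
      then obtain j where j: "y $ j \<notin> {lo j..hi j}" by (auto simp: K_def mem_box_cart)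
      then have "(\<Prod>i\<in>UNIV. (if i = k then (\<lambda>s. \<bar>g s\<bar> powr p * s powr (- \<beta> - p - 1)) else (\<lambda>s. bump s powr p)) (y $ i)) = 0"
        using G0(1)[OF j] by (intro prod_zero bexI[of _ j]) (auto simp: G_def)
      then show ?thesis using F0[OF False] by simp
    qed
    then show ?thesis
      using tensor[OF int[OF smooth_real_continuous[OF g(1)] g(4)], of "- \<beta> - p - 1"] by simp
  qed
  have I_E: "(LBINT y. \<bar>\<nu> k * P k y\<bar> powr p / (R powr (\<alpha> + p) * (y $ k / \<nu> k) powr (\<beta> + 1)))
      = W * ((LBINT s. \<bar>g' s\<bar> powr p * s powr (- \<beta> - 1)) * B)"
  proof -
    have "\<bar>\<nu> k * P k y\<bar> powr p / (R powr (\<alpha> + p) * (y $ k / \<nu> k) powr (\<beta> + 1))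
        = W * (\<Prod>i\<in>UNIV. (if i = k then (\<lambda>s. \<bar>g' s\<bar> powr p * s powr (- \<beta> - 1)) else (\<lambda>s. bump s powr p)) (y $ i))" for y
    proof (cases "y \<in> K")
      case True
      then have y: "0 < y $ k" using yk ab by force
      have "(y $ k) powr (- \<beta> - 1) = 1 / (y $ k) powr (\<beta> + 1)"
        by (simp add: powr_minus_divide[symmetric])
      moreover have "\<bar>P k y\<bar> powr p = \<bar>g' (y $ k)\<bar> powr p * (\<Prod>i\<in>UNIV - {k}. bump (y $ i) powr p)"
        unfolding P_def partial_tensor_def abs_prod_powr using bump_nonneg
        by (subst prod.remove[of _ k]) (auto simp: G_def G'_def intro!: prod.cong)
      moreover have "(\<Prod>i\<in>UNIV. (if i = k then (\<lambda>s. \<bar>g' s\<bar> powr p * s powr (- \<beta> - 1)) else (\<lambda>s. bump s powr p)) (y $ i))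
          = \<bar>g' (y $ k)\<bar> powr p * (y $ k) powr (- \<beta> - 1) * (\<Prod>i\<in>UNIV - {k}. bump (y $ i) powr p)"
        by (subst prod.remove[of _ k]) (auto intro!: prod.cong)
      moreover have "\<nu> k powr (\<beta> + p + 1) = \<nu> k powr p * \<nu> k powr (\<beta> + 1)"
        by (simp add: powr_add[symmetric] algebra_simps)
      ultimately show ?thesis
        using y nu by (simp add: W_def powr_divide abs_mult powr_mult)
    next
      case False
      then obtain j where j: "y $ j \<notin> {lo j..hi j}" by (auto simp: K_def mem_box_cart)
      then have "(\<Prod>i\<in>UNIV. (if i = k then (\<lambda>s. \<bar>g' s\<bar> powr p * s powr (- \<beta> - 1)) else (\<lambda>s. bump s powr p)) (y $ i)) = 0"
        using G0[OF j] by (intro prod_zero bexI[of _ j]) (auto simp: G_def G'_def)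
      then show ?thesis using P0[OF False] by simp
    qed
    then show ?thesis
      using tensor[OF int[OF g(3,5)], of "- \<beta> - 1"] by simp
  qed
  have "(LBINT y. \<bar>\<nu> k * P k y\<bar> powr p / (R powr (\<alpha> + p) * (y $ k / \<nu> k) powr (\<beta> + 1)))
      < C * (LBINT y. \<bar>F y\<bar> powr p / (R powr (\<alpha> + p) * (y $ k / \<nu> k) powr (\<beta> + p + 1)))"
    unfolding I_F I_E using mult_strict_left_mono[OF profile, of "W * B"] W B by (simp add: mult_ac)
  moreover from tendsto_diff[OF tendsto_mult[OF tendsto_const[of C] lim_F] lim_E]
  have "eventually (\<lambda>n. 0 < C * (LBINT y. \<bar>F y\<bar> powr p / (q (\<psi> n y) powr (\<alpha> + p) * L n y powr (\<beta> + p + 1)))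
      - (LBINT y. \<bar>E' n y\<bar> powr p / (q (\<psi> n y) powr (\<alpha> + p) * L n y powr (\<beta> + 1)))) sequentially"
    by (rule order_tendstoD(1)) (use calculation in simp)
  ultimately obtain n where n: "(LBINT y. \<bar>E' n y\<bar> powr p / (q (\<psi> n y) powr (\<alpha> + p) * L n y powr (\<beta> + 1)))
      < C * (LBINT y. \<bar>F y\<bar> powr p / (q (\<psi> n y) powr (\<alpha> + p) * L n y powr (\<beta> + p + 1)))"
    by (auto simp: eventually_sequentially)
  have off: "(\<Prod>i\<in>UNIV. G i (y $ i)) = 0" if "y \<notin> K" for y using F0[OF that] by (simp only: F_def)
  have inside: "0 < q (tube_map k c (m n) (\<delta> n) y) \<and> q (tube_map k c (m n) (\<delta> n) y) < R" if "y \<in> K" for y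
    using \<delta>(2)[OF that] q_less[OF that] by (simp add: \<psi>_def)
  note integrals = tube_fun_integrals[OF R p c m0[of n] \<delta>(1)[of n] G(1,2) K off inside]
  obtain J where J: "0 < J" "test_fun q R (tube_fun k c (m n) (\<delta> n) G)"
    "\<And>a b. wint q R a b (\<lambda>x. cmod (tube_fun k c (m n) (\<delta> n) G x) powr p)
      = J * (LBINT y. \<bar>F y\<bar> powr p / (q (\<psi> n y) powr a * logw q R (\<psi> n y) powr b))"
    "\<And>\<alpha> b. wint q R \<alpha> b (\<lambda>x. cmod (radial_deriv \<nu> q (tube_fun k c (m n) (\<delta> n) G) x) powr p)
      = J * (LBINT y. \<bar>E n y\<bar> powr p / (q (\<psi> n y) powr (\<alpha> + p) * logw q R (\<psi> n y) powr b))"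
    using integrals[folded F_def P_def \<psi>_def, folded E_def] by blast
  \<comment> \<open>For f this power of m comes entirely from \<open>logw\<close>; for the
    derivative, m^p comes from \<open>E n = m n * E' n\<close> and m^(\<beta>+1) from
    \<open>logw\<close>.\<close>
  define T where "T = m n powr (\<beta> + p + 1)"
  have T: "0 < T" using m0[of n] by (simp add: T_def)
  have logw_powr: "logw q R (\<psi> n y) powr r = L n y powr r / m n powr r" if "y \<in> K" for y r
    using L_range[OF that, of n] l0 m0[of n] unfolding logw_eq by (simp add: powr_mult inverse_powr divide_inverse)
  have "\<bar>F y\<bar> powr p / (q (\<psi> n y) powr (\<alpha> + p) * logw q R (\<psi> n y) powr (\<beta> + p + 1))
      = T * (\<bar>F y\<bar> powr p / (q (\<psi> n y) powr (\<alpha> + p) * L n y powr (\<beta> + p + 1)))" for y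
    using F0 logw_powr by (cases "y \<in> K") (auto simp: T_def)
  then have 1: "wint q R (\<alpha> + p) (\<beta> + p + 1) (\<lambda>x. cmod (tube_fun k c (m n) (\<delta> n) G x) powr p)
      = J * (T * (LBINT y. \<bar>F y\<bar> powr p / (q (\<psi> n y) powr (\<alpha> + p) * L n y powr (\<beta> + p + 1))))"
    unfolding J(3) by (simp only: integral_mult_right_zero)
  have "\<bar>E n y\<bar> powr p / (q (\<psi> n y) powr (\<alpha> + p) * logw q R (\<psi> n y) powr (\<beta> + 1))
      = T * (\<bar>E' n y\<bar> powr p / (q (\<psi> n y) powr (\<alpha> + p) * L n y powr (\<beta> + 1)))" for y
  proof (cases "y \<in> K")
    case True
    have "m n powr (\<beta> + p + 1) = m n powr p * m n powr (\<beta> + 1)"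
      by (simp add: powr_add[symmetric] algebra_simps)
    then show ?thesis
      using m0[of n] by (simp add: E_E' T_def logw_powr[OF True] abs_mult powr_mult)
  next
    case False
    then show ?thesis using P0 by (simp add: E_def E'_def)
  qed
  then have 2: "wint q R \<alpha> (\<beta> + 1) (\<lambda>x. cmod (radial_deriv \<nu> q (tube_fun k c (m n) (\<delta> n) G) x) powr p)
      = J * (T * (LBINT y. \<bar>E' n y\<bar> powr p / (q (\<psi> n y) powr (\<alpha> + p) * L n y powr (\<beta> + 1))))"
    unfolding J(4) by (simp only: integral_mult_right_zero)
  show ?thesis
  proof (intro exI conjI)
    show "test_fun q R (tube_fun k c (m n) (\<delta> n) G)" by (rule J(2))
    show "wint q R \<alpha> (\<beta> + 1) (\<lambda>x. cmod (radial_deriv \<nu> q (tube_fun k c (m n) (\<delta> n) G) x) powr p)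
      < C * wint q R (\<alpha> + p) (\<beta> + p + 1) (\<lambda>x. cmod (tube_fun k c (m n) (\<delta> n) G x) powr p)"
      unfolding 1 2 using mult_strict_left_mono[OF n, of "J * T"] J(1) T by (simp add: mult_ac)
  qed
qed

end

theorem theorem4p2:
  fixes \<nu> :: "'n::finite \<Rightarrow> real"
    and mul :: "real^'n \<Rightarrow> real^'n \<Rightarrow> real^'n"
    and ginv :: "real^'n \<Rightarrow> real^'n"
    and q :: "real^'n \<Rightarrow> real"
    and R p \<alpha> \<beta> :: real
  assumes G: "homogeneous_group \<nu> mul ginv"
    and N: "hom_quasi_norm \<nu> ginv q"
    and R: "R > 0"
    and p: "1 < p"
  shows
    \<comment> \<open>(i) inequality and sharpness\<close>
    "((hom_dim \<nu> - \<alpha> - p) * (\<beta> + p) \<ge> 0 \<longrightarrow>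
        (\<forall>f. test_fun q R f \<longrightarrow>
           \<bar>(\<beta> + p) / p\<bar> powr p * wint q R (\<alpha> + p) (\<beta> + p + 1) (\<lambda>x. cmod (f x) powr p)
             \<le> wint q R \<alpha> (\<beta> + 1) (\<lambda>x. cmod (radial_deriv \<nu> q f x) powr p)) \<and>
        (\<beta> \<noteq> - p \<longrightarrow>
           (\<forall>C > \<bar>(\<beta> + p) / p\<bar> powr p. \<exists>f. test_fun q R f \<and>
              C * wint q R (\<alpha> + p) (\<beta> + p + 1) (\<lambda>x. cmod (f x) powr p)
                > wint q R \<alpha> (\<beta> + 1) (\<lambda>x. cmod (radial_deriv \<nu> q f x) powr p))))
     \<and>
    \<comment> \<open>(ii) identity\<close>
     (\<forall>f. test_fun q R f \<longrightarrow>
        \<bar>(\<beta> + p) / p\<bar> powr p * wint q R (\<alpha> + p) (\<beta> + p + 1) (\<lambda>x. cmod (f x) powr p)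
        = wint q R \<alpha> (\<beta> + 1) (\<lambda>x. cmod (radial_deriv \<nu> q f x) powr p)
          - (hom_dim \<nu> - \<alpha> - p) * ((\<beta> + p) / p) * \<bar>(\<beta> + p) / p\<bar> powr (p - 2)
              * wint q R (\<alpha> + p) (\<beta> + p) (\<lambda>x. cmod (f x) powr p)
          - (LINT x:{x. q x < R}|lebesgue.
               Cp p (xi_fun \<nu> q R \<alpha> \<beta> p f x) (eta_fun \<nu> q R \<alpha> \<beta> p f x)))
     \<and>
    \<comment> \<open>(iii) vanishing of the remainder and strictness\<close>
     (hom_dim \<nu> = \<alpha> + p \<and> 2 \<le> p \<longrightarrow>
        (\<forall>f. test_fun q R f \<longrightarrow>
           ((LINT x:{x. q x < R}|lebesgue.
               Cp p (xi_fun \<nu> q R \<alpha> \<beta> p f x) (eta_fun \<nu> q R \<alpha> \<beta> p f x)) = 0 \<longrightarrow>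
              (\<exists>\<phi> :: real^'n \<Rightarrow> complex. \<forall>x. 0 < q x \<and> q x < R \<longrightarrow>
                 f x = complex_of_real (logw q R x powr ((\<beta> + p) / p)) * \<phi> (dil \<nu> (1 / q x) x))
              \<and> (\<forall>x. f x = 0)) \<and>
           ((\<exists>x. f x \<noteq> 0) \<longrightarrow>
              \<bar>(\<beta> + p) / p\<bar> powr p * wint q R (\<alpha> + p) (\<beta> + p + 1) (\<lambda>x. cmod (f x) powr p)
                < wint q R \<alpha> (\<beta> + 1) (\<lambda>x. cmod (radial_deriv \<nu> q f x) powr p))))"
proof -
  interpret homogeneous_norm \<nu> q
    using G N by unfold_locales (auto simp: homogeneous_group_def hom_quasi_norm_def)
  let ?C = "\<lambda>f. LINT x:{x. q x < R}|lebesgue. Cp p (xi_fun \<nu> q R \<alpha> \<beta> p f x) (eta_fun \<nu> q R \<alpha> \<beta> p f x)"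
  have ineq: "\<bar>(\<beta> + p) / p\<bar> powr p * wint q R (\<alpha> + p) (\<beta> + p + 1) (\<lambda>x. cmod (f x) powr p)
      \<le> wint q R \<alpha> (\<beta> + 1) (\<lambda>x. cmod (radial_deriv \<nu> q f x) powr p)"
    if "0 \<le> (hom_dim \<nu> - \<alpha> - p) * (\<beta> + p)" "test_fun q R f" for f
    by (rule hardy_inequality[OF R p that(2,1)])
  have sharp: "\<exists>f. test_fun q R f \<and> C * wint q R (\<alpha> + p) (\<beta> + p + 1) (\<lambda>x. cmod (f x) powr p)
      > wint q R \<alpha> (\<beta> + 1) (\<lambda>x. cmod (radial_deriv \<nu> q f x) powr p)"
    if "\<bar>(\<beta> + p) / p\<bar> powr p < C" for C
    by (rule hardy_constant_sharp[OF R p that])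
  have ident: "\<bar>(\<beta> + p) / p\<bar> powr p * wint q R (\<alpha> + p) (\<beta> + p + 1) (\<lambda>x. cmod (f x) powr p)
      = wint q R \<alpha> (\<beta> + 1) (\<lambda>x. cmod (radial_deriv \<nu> q f x) powr p)
        - (hom_dim \<nu> - \<alpha> - p) * ((\<beta> + p) / p) * \<bar>(\<beta> + p) / p\<bar> powr (p - 2)
            * wint q R (\<alpha> + p) (\<beta> + p) (\<lambda>x. cmod (f x) powr p)
        - ?C f" if "test_fun q R f" for f
    using remainder_identity(2)[OF R p that, of \<alpha> \<beta>] by linarith
  have vanish: "f x = 0" if "test_fun q R f" "?C f = 0" for f x
    by (rule remainder_zero_imp_zero[OF R p that])
  have strict: "\<bar>(\<beta> + p) / p\<bar> powr p * wint q R (\<alpha> + p) (\<beta> + p + 1) (\<lambda>x. cmod (f x) powr p)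
      < wint q R \<alpha> (\<beta> + 1) (\<lambda>x. cmod (radial_deriv \<nu> q f x) powr p)"
    if Q: "hom_dim \<nu> = \<alpha> + p" and f: "test_fun q R f" and nz: "f x \<noteq> 0" for f x
  proof -
    have "?C f \<noteq> 0" using vanish[OF f, of x] nz by blast
    moreover have "?C f = wint q R \<alpha> (\<beta> + 1) (\<lambda>x. cmod (radial_deriv \<nu> q f x) powr p)
        - \<bar>(\<beta> + p) / p\<bar> powr p * wint q R (\<alpha> + p) (\<beta> + p + 1) (\<lambda>x. cmod (f x) powr p)"
      using ident[OF f] Q by simp
    ultimately show ?thesis using ineq[OF _ f] Q by simp
  qed
  \<comment> \<open>Since a vanishing remainder already forces f = 0, the zero function serves as
    the angular profile \<phi>.\<close>
  show ?thesis
    using ineq sharp ident vanish strict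
    by (intro conjI impI allI) (blast | (rule exI[of _ "\<lambda>_. 0"], simp))+
qed

end
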